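(* Let $n\geq 2$. There is a constant $C_n>0$ depending only on $n$ such that the following holds for every integer $d\geq 1$. Let $\mathcal{C}$ be a finite collection of irreducible, smooth algebraic curves in $\mathbb{R}^n$, each of degree at most $d$, and let $J$ denote the set of joints determined by $\mathcal{C}$. Then $|J|\leq C_n|\mathcal{C}|^{n/(n-1)}d^{n/(n-1)}$.
   Context: An irreducible algebraic curve in $\mathbb{R}^n$ is an irreducible real algebraic subset of $\mathbb{R}^n$ of dimension $1$; its degree is the degree of its Zariski closure in complex projective space $\mathbb{P}^n(\mathbb{C})$. A curve $\gamma$ is smooth if its tangent vector exists at every point of $\gamma$ and is nonzero: for every $p\in\gamma$, some neighbourhood of $p$ in $\gamma$ is parametrized homeomorphically by an open interval via a differentiable map with nonzero derivative; the derivative at the parameter of $p$ is the tangent vector of $\gamma$ at $p$ (determined up to a nonzero scalar). For a collection $\mathcal{C}$ (a set) of smooth curves, a joint determined by $\mathcal{C}$ is a point $x\in\mathbb{R}^n$ for which there exist $n$ curves in $\mathcal{C}$ passing through $x$ whose tangent vectors at $x$ are linearly independent. $|S|$ denotes the cardinality of a set $S$. *)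

theory Defs
  imports
    "HOL-Analysis.Analysis"
    "HOL-Library.Poly_Mapping"
    "HOL-Library.Extended_Nat"
    "HOL-Computational_Algebra.Polynomial"
begin

subsection \<open>Multivariate polynomials\<close>

text \<open>A polynomial in variables indexed by \<open>'v\<close> is a finitely supported map from exponent
  vectors to coefficients.\<close>

type_synonym ('v, 'a) mpoly = "('v \<Rightarrow>\<^sub>0 nat) \<Rightarrow>\<^sub>0 'a"

definition monom_eval :: "('v \<Rightarrow>\<^sub>0 nat) \<Rightarrow> ('v \<Rightarrow> 'a::comm_semiring_1) \<Rightarrow> 'a" where
  "monom_eval \<alpha> x = (\<Prod>v\<in>Poly_Mapping.keys \<alpha>. x v ^ Poly_Mapping.lookup \<alpha> v)"

definition mpoly_eval :: "('v, 'a::comm_semiring_1) mpoly \<Rightarrow> ('v \<Rightarrow> 'a) \<Rightarrow> 'a" where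
  "mpoly_eval p x = (\<Sum>\<alpha>\<in>Poly_Mapping.keys p. Poly_Mapping.lookup p \<alpha> * monom_eval \<alpha> x)"

definition mpoly_vars :: "('v, 'a::zero) mpoly \<Rightarrow> 'v set" where
  "mpoly_vars p = (\<Union>\<alpha>\<in>Poly_Mapping.keys p. Poly_Mapping.keys \<alpha>)"

definition monom_degree :: "('v \<Rightarrow>\<^sub>0 nat) \<Rightarrow> nat" where
  "monom_degree \<alpha> = (\<Sum>v\<in>Poly_Mapping.keys \<alpha>. Poly_Mapping.lookup \<alpha> v)"

text \<open>\<open>homogeneous m\<close> is the space of forms of degree \<open>m\<close>, including \<open>0\<close>.\<close>

definition homogeneous :: "nat \<Rightarrow> ('v, 'a::zero) mpoly set" where
  "homogeneous m = {p. \<forall>\<alpha>\<in>Poly_Mapping.keys p. monom_degree \<alpha> = m}"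

definition mpoly_scale :: "'a::field \<Rightarrow> ('v, 'a) mpoly \<Rightarrow> ('v, 'a) mpoly" where
  "mpoly_scale c p = Poly_Mapping.map ((*) c) p"

lemma lookup_mpoly_scale:
  "Poly_Mapping.lookup (mpoly_scale c p) \<alpha> = c * Poly_Mapping.lookup p \<alpha>"
  by (simp add: mpoly_scale_def Poly_Mapping.map.rep_eq when_def)

interpretation mpoly: vector_space mpoly_scale
  by unfold_locales
    (simp_all add: poly_mapping_eq_iff fun_eq_iff lookup_mpoly_scale lookup_add algebra_simps)


subsection \<open>Real algebraic sets\<close>

definition real_zeros :: "('n::finite, real) mpoly set \<Rightarrow> (real ^ 'n) set" where
  "real_zeros F = {x. \<forall>p\<in>F. mpoly_eval p (\<lambda>i. x $ i) = 0}"

definition real_algebraic :: "(real ^ 'n::finite) set \<Rightarrow> bool" where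
  "real_algebraic V \<longleftrightarrow> (\<exists>F. V = real_zeros F)"

definition irreducible_real_algebraic :: "(real ^ 'n::finite) set \<Rightarrow> bool" where
  "irreducible_real_algebraic V \<longleftrightarrow>
     real_algebraic V \<and> V \<noteq> {} \<and>
     (\<forall>A B. real_algebraic A \<and> real_algebraic B \<and> V = A \<union> B \<longrightarrow> V = A \<or> V = B)"

text \<open>\<open>algebraically_independent_on V k f\<close>: the classes of the polynomials \<open>f 0, \<dots>, f (k - 1)\<close> in the
  coordinate ring of \<open>V\<close> (polynomials modulo those vanishing on \<open>V\<close>) are algebraically independent
  over the reals.\<close>

definition algebraically_independent_on ::
    "(real ^ 'n::finite) set \<Rightarrow> nat \<Rightarrow> (nat \<Rightarrow> ('n, real) mpoly) \<Rightarrow> bool" where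
  "algebraically_independent_on V k f \<longleftrightarrow>
     (\<forall>Q :: (nat, real) mpoly.
        mpoly_vars Q \<subseteq> {..<k} \<and>
        (\<forall>x\<in>V. mpoly_eval Q (\<lambda>j. mpoly_eval (f j) (\<lambda>i. x $ i)) = 0) \<longrightarrow> Q = 0)"

text \<open>The dimension of an irreducible algebraic set is the transcendence degree over the reals of
  its coordinate ring (equivalently, of its field of rational functions).\<close>

definition irreducible_dim :: "(real ^ 'n::finite) set \<Rightarrow> enat" where
  "irreducible_dim V = Sup {enat k |k. \<exists>f. algebraically_independent_on V k f}"

definition irreducible_algebraic_curve :: "(real ^ 'n::finite) set \<Rightarrow> bool" where
  "irreducible_algebraic_curve \<gamma> \<longleftrightarrow> irreducible_real_algebraic \<gamma> \<and> irreducible_dim \<gamma> = 1"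


subsection \<open>Complex projective space and degree\<close>

text \<open>A point of complex projective space is the set of all its vectors of homogeneous coordinates.
  These are indexed by \<open>'n option\<close>, with \<open>None\<close> for the homogenizing coordinate.\<close>

type_synonym 'n proj_point = "(complex ^ 'n option) set"

definition proj_class :: "complex ^ 'n::finite option \<Rightarrow> 'n proj_point" where
  "proj_class z = {c *s z |c. c \<noteq> 0}"

definition proj_space :: "'n::finite proj_point set" where
  "proj_space = proj_class ` (UNIV - {0})"

definition vanishes_at :: "('n::finite option, complex) mpoly \<Rightarrow> 'n proj_point \<Rightarrow> bool" where
  "vanishes_at F P \<longleftrightarrow> (\<forall>z\<in>P. mpoly_eval F (\<lambda>i. z $ i) = 0)"

definition proj_algebraic :: "'n::finite proj_point set \<Rightarrow> bool" where
  "proj_algebraic X \<longleftrightarrow>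
     (\<exists>S \<subseteq> (\<Union>m. homogeneous m). X = {P \<in> proj_space. \<forall>F\<in>S. vanishes_at F P})"

definition zariski_closure :: "'n::finite proj_point set \<Rightarrow> 'n proj_point set" where
  "zariski_closure S = \<Inter> {X. proj_algebraic X \<and> S \<subseteq> X}"

definition vanishing_forms ::
    "'n::finite proj_point set \<Rightarrow> nat \<Rightarrow> ('n option, complex) mpoly set" where
  "vanishing_forms X m = {F \<in> homogeneous m. \<forall>P\<in>X. vanishes_at F P}"

text \<open>The dimension of the degree \<open>m\<close> part of the homogeneous coordinate ring of \<open>X\<close>, that is, of
  the quotient of the finite-dimensional space of all forms of degree \<open>m\<close> by the subspace of
  those vanishing on \<open>X\<close>.\<close>

definition hilbert_function :: "'n::finite proj_point set \<Rightarrow> nat \<Rightarrow> nat" where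
  "hilbert_function X m =
     mpoly.dim (homogeneous m :: ('n option, complex) mpoly set) - mpoly.dim (vanishing_forms X m)"

definition hilbert_polynomial :: "'n::finite proj_point set \<Rightarrow> real poly" where
  "hilbert_polynomial X =
     (THE P. \<forall>\<^sub>F m in sequentially. real (hilbert_function X m) = poly P (real m))"

text \<open>The degree of a projective algebraic set of dimension \<open>r\<close> is \<open>r!\<close> times the leading
  coefficient of its Hilbert polynomial, whose degree is \<open>r\<close>.\<close>

definition proj_degree :: "'n::finite proj_point set \<Rightarrow> real" where
  "proj_degree X =
     fact (degree (hilbert_polynomial X)) * lead_coeff (hilbert_polynomial X)"

definition proj_embed :: "real ^ 'n::finite \<Rightarrow> 'n proj_point" where
  "proj_embed x =
     proj_class (\<chi> i. case i of None \<Rightarrow> 1 | Some j \<Rightarrow> complex_of_real (x $ j))"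

definition alg_degree :: "(real ^ 'n::finite) set \<Rightarrow> real" where
  "alg_degree \<gamma> = proj_degree (zariski_closure (proj_embed ` \<gamma>))"


subsection \<open>Smooth curves and joints\<close>

definition local_parametrization ::
    "(real ^ 'n::finite) set \<Rightarrow> real ^ 'n \<Rightarrow> real set \<Rightarrow> (real \<Rightarrow> real ^ 'n) \<Rightarrow> real \<Rightarrow> bool" where
  "local_parametrization \<gamma> p I g t \<longleftrightarrow>
     open I \<and> is_interval I \<and> t \<in> I \<and> g t = p \<and>
     (\<exists>U h. openin (top_of_set \<gamma>) U \<and> homeomorphism I U g h) \<and>
     (\<forall>s\<in>I. g differentiable (at s) \<and> vector_derivative g (at s) \<noteq> 0)"

definition smooth_curve :: "(real ^ 'n::finite) set \<Rightarrow> bool" where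
  "smooth_curve \<gamma> \<longleftrightarrow> (\<forall>p\<in>\<gamma>. \<exists>I g t. local_parametrization \<gamma> p I g t)"

definition tangent_vector :: "(real ^ 'n::finite) set \<Rightarrow> real ^ 'n \<Rightarrow> real ^ 'n \<Rightarrow> bool" where
  "tangent_vector \<gamma> p v \<longleftrightarrow>
     (\<exists>I g t. local_parametrization \<gamma> p I g t \<and> v = vector_derivative g (at t))"

definition joints :: "(real ^ 'n::finite) set set \<Rightarrow> (real ^ 'n) set" where
  "joints C =
     {x. \<exists>(c :: 'n \<Rightarrow> (real ^ 'n) set) (v :: 'n \<Rightarrow> real ^ 'n).
           inj c \<and> (\<forall>i. c i \<in> C \<and> x \<in> c i \<and> tangent_vector (c i) x (v i)) \<and>
           inj v \<and> independent (range v)}"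

end

theory Submission
  imports Defs
begin

text \<open>Let \<open>J\<close> be a finite set of joints and \<open>Q\<close> a nonzero polynomial of least degree \<open>k\<close> vanishing on
  \<open>J\<close>; counting coefficients gives \<open>k \<le> n |J|\<^bsup>1/n\<^esup>\<close>. If every curve contained more than \<open>d k\<close> points of
  \<open>J\<close>, then \<open>Q\<close> would vanish on every curve, so its gradient would be orthogonal to \<open>n\<close> independent
  tangent vectors at each joint; the partial derivatives would contradict minimality. Hence some curve
  contains at most \<open>d n |J|\<^bsup>1/n\<^esup>\<close> points of \<open>J\<close>, and removing the curves one by one bounds \<open>|J|\<close>.

  The Bezout bound comes from the Hilbert function \<open>H\<close> of the curve: multiplication by \<open>Q\<close> together
  with polynomials separating the zeros shows \<open>H(m) + |Z| \<le> H(m + k)\<close> for the zeros \<open>Z\<close> of \<open>Q\<close> on the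
  curve and large \<open>m\<close>. Here \<open>H(m)\<close> counts the monomials of degree at most \<open>m\<close> that are not leading
  monomials of the vanishing ideal. As the curve is one-dimensional, the powers of a product of two
  distinct variables are eventually leading monomials, which forces \<open>H\<close> to be eventually linear, with
  slope at most the degree of the curve.\<close>

subsection \<open>Evaluation and degree\<close>

lemma monom_degree_UNIV:
  fixes \<alpha> :: "'v::finite \<Rightarrow>\<^sub>0 nat"
  shows "monom_degree \<alpha> = (\<Sum>v\<in>UNIV. Poly_Mapping.lookup \<alpha> v)"
  unfolding monom_degree_def
  by (rule sum.mono_neutral_left) (auto simp: in_keys_iff)

lemma monom_eval_UNIV:
  fixes \<alpha> :: "'v::finite \<Rightarrow>\<^sub>0 nat"
  shows "monom_eval \<alpha> x = (\<Prod>v\<in>UNIV. x v ^ Poly_Mapping.lookup \<alpha> v)"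
  unfolding monom_eval_def
  by (rule prod.mono_neutral_left) (auto simp: in_keys_iff)

lemma monom_eval_superset:
  assumes "finite S" "Poly_Mapping.keys \<alpha> \<subseteq> S"
  shows "monom_eval \<alpha> x = (\<Prod>v\<in>S. x v ^ Poly_Mapping.lookup \<alpha> v)"
  unfolding monom_eval_def
  by (rule prod.mono_neutral_left) (use assms in \<open>auto simp: in_keys_iff\<close>)

lemma monom_eval_add: "monom_eval (\<alpha> + \<beta>) x = monom_eval \<alpha> x * monom_eval \<beta> x"
proof -
  let ?S = "Poly_Mapping.keys \<alpha> \<union> Poly_Mapping.keys \<beta>"
  have "Poly_Mapping.keys (\<alpha> + \<beta>) \<subseteq> ?S" by (rule keys_add)
  then show ?thesis
    by (simp add: monom_eval_superset[of ?S] lookup_add power_add prod.distrib)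
qed

lemma monom_eval_zero [simp]: "monom_eval 0 x = 1"
  by (simp add: monom_eval_def)

lemma monom_eval_single [simp]: "monom_eval (Poly_Mapping.single v k) x = x v ^ k"
  by (cases "k = 0") (simp_all add: monom_eval_def)

lemma mpoly_eval_superset:
  assumes "finite S" "Poly_Mapping.keys p \<subseteq> S"
  shows "mpoly_eval p x = (\<Sum>\<alpha>\<in>S. Poly_Mapping.lookup p \<alpha> * monom_eval \<alpha> x)"
  unfolding mpoly_eval_def
  by (rule sum.mono_neutral_left) (use assms in \<open>auto simp: in_keys_iff\<close>)

lemma mpoly_eval_zero [simp]: "mpoly_eval 0 x = 0"
  by (simp add: mpoly_eval_def)

lemma mpoly_eval_add: "mpoly_eval (p + q) x = mpoly_eval p x + mpoly_eval q x"
proof -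
  let ?S = "Poly_Mapping.keys p \<union> Poly_Mapping.keys q"
  have "Poly_Mapping.keys (p + q) \<subseteq> ?S" by (rule keys_add)
  then show ?thesis
    by (simp add: mpoly_eval_superset[of ?S] lookup_add distrib_right sum.distrib)
qed

lemma mpoly_eval_single [simp]: "mpoly_eval (Poly_Mapping.single \<alpha> c) x = c * monom_eval \<alpha> x"
  by (cases "c = 0") (simp_all add: mpoly_eval_def)

lemma mpoly_eval_one [simp]: "mpoly_eval 1 x = 1"
  by (simp add: mpoly_eval_def lookup_one)

lemma mpoly_eval_sum: "mpoly_eval (sum f A) x = (\<Sum>a\<in>A. mpoly_eval (f a) x)"
  by (induction A rule: infinite_finite_induct) (simp_all add: mpoly_eval_add)

lemma poly_mapping_sum_single:
  "p = (\<Sum>\<alpha>\<in>Poly_Mapping.keys p. Poly_Mapping.single \<alpha> (Poly_Mapping.lookup p \<alpha>))"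
proof (rule poly_mapping_eqI)
  fix \<beta>
  show "Poly_Mapping.lookup p \<beta> =
      Poly_Mapping.lookup (\<Sum>\<alpha>\<in>Poly_Mapping.keys p. Poly_Mapping.single \<alpha> (Poly_Mapping.lookup p \<alpha>)) \<beta>"
    by (simp add: lookup_sum lookup_single when_def in_keys_iff)
qed

lemma mpoly_eval_mult: "mpoly_eval (p * q) x = mpoly_eval p x * mpoly_eval q x"
proof -
  have "p * q = (\<Sum>\<alpha>\<in>Poly_Mapping.keys p. \<Sum>\<beta>\<in>Poly_Mapping.keys q.
      Poly_Mapping.single (\<alpha> + \<beta>) (Poly_Mapping.lookup p \<alpha> * Poly_Mapping.lookup q \<beta>))"
    by (subst (1) poly_mapping_sum_single[of p], subst (1) poly_mapping_sum_single[of q])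
       (simp add: sum_product mult_single)
  then have "mpoly_eval (p * q) x = (\<Sum>\<alpha>\<in>Poly_Mapping.keys p. \<Sum>\<beta>\<in>Poly_Mapping.keys q.
      (Poly_Mapping.lookup p \<alpha> * monom_eval \<alpha> x) * (Poly_Mapping.lookup q \<beta> * monom_eval \<beta> x))"
    by (simp add: mpoly_eval_sum monom_eval_add mult_ac)
  then show ?thesis by (simp add: mpoly_eval_def sum_product)
qed

lemma mpoly_eval_scale: "mpoly_eval (mpoly_scale c p) x = c * mpoly_eval p x"
proof -
  have "Poly_Mapping.keys (mpoly_scale c p) \<subseteq> Poly_Mapping.keys p"
    by (auto simp: in_keys_iff lookup_mpoly_scale)
  then show ?thesis
    by (simp add: mpoly_eval_superset[of "Poly_Mapping.keys p"] lookup_mpoly_scale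
        sum_distrib_left mult_ac)
qed

lemma mpoly_eval_diff: "mpoly_eval (p - q) x = mpoly_eval p x - mpoly_eval q (x :: _ \<Rightarrow> _ :: comm_ring_1)"
  using mpoly_eval_add[of "p - q" q x] by simp

lemma monom_degree_add: "monom_degree (\<alpha> + \<beta>) = monom_degree \<alpha> + monom_degree (\<beta> :: 'v::finite \<Rightarrow>\<^sub>0 nat)"
  by (simp add: monom_degree_UNIV lookup_add sum.distrib)

lemma monom_degree_single [simp]: "monom_degree (Poly_Mapping.single (v :: 'v::finite) k) = k"
  by (simp add: monom_degree_UNIV lookup_single when_def)

lemma lookup_le_monom_degree: "Poly_Mapping.lookup \<alpha> (v :: 'v::finite) \<le> monom_degree \<alpha>"
  unfolding monom_degree_UNIV by (rule member_le_sum) auto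

lemma lookup_Abs_finite [simp]: "Poly_Mapping.lookup (Abs_poly_mapping (f :: 'v::finite \<Rightarrow> _)) = f"
  by (rule lookup_Abs_poly_mapping) simp

lemma finite_bounded_exponents:
  "finite {\<alpha> :: 'v::finite \<Rightarrow>\<^sub>0 nat. \<forall>v. Poly_Mapping.lookup \<alpha> v \<le> m}"
proof -
  have "finite (PiE (UNIV :: 'v set) (\<lambda>_. {..m}))" by (simp add: finite_PiE)
  moreover have "Poly_Mapping.lookup ` {\<alpha> :: 'v \<Rightarrow>\<^sub>0 nat. \<forall>v. Poly_Mapping.lookup \<alpha> v \<le> m}
      \<subseteq> PiE (UNIV :: 'v set) (\<lambda>_. {..m})"
    by (auto simp: PiE_def)
  ultimately have "finite (Poly_Mapping.lookup ` {\<alpha> :: 'v \<Rightarrow>\<^sub>0 nat. \<forall>v. Poly_Mapping.lookup \<alpha> v \<le> m})"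
    by (rule rev_finite_subset)
  then show ?thesis
    by (rule finite_imageD) (auto simp: inj_on_def)
qed

lemma finite_monom_degree_le: "finite {\<alpha> :: 'v::finite \<Rightarrow>\<^sub>0 nat. monom_degree \<alpha> \<le> m}"
  by (rule finite_subset[OF _ finite_bounded_exponents[of m]])
     (auto intro: order_trans[OF lookup_le_monom_degree])

definition mpolys_le :: "nat \<Rightarrow> ('v, 'a::zero) mpoly set" where
  "mpolys_le m = {p. \<forall>\<alpha>\<in>Poly_Mapping.keys p. monom_degree \<alpha> \<le> m}"

lemma mpolys_le_mult:
  fixes p q :: "('v::finite, 'a::comm_ring_1) mpoly"
  assumes "p \<in> mpolys_le k" "q \<in> mpolys_le m"
  shows "p * q \<in> mpolys_le (k + m)"
proof -
  { fix \<alpha> assume "\<alpha> \<in> Poly_Mapping.keys (p * q)"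
    then obtain a b where "\<alpha> = a + b" "a \<in> Poly_Mapping.keys p" "b \<in> Poly_Mapping.keys q"
      using keys_mult[of p q] by blast
    then have "monom_degree \<alpha> \<le> k + m"
      using assms by (auto simp: mpolys_le_def monom_degree_add intro!: add_mono) }
  then show ?thesis by (simp add: mpolys_le_def)
qed

lemma mpolys_le_mono: "m \<le> k \<Longrightarrow> mpolys_le m \<subseteq> mpolys_le k"
  by (auto simp: mpolys_le_def)

lemma mpolys_le_exists: "\<exists>m. p \<in> mpolys_le m"
proof
  \<comment> \<open>For \<open>p = 0\<close> the maximum is over the empty set and has no known
    value, but then there is no exponent to check.\<close>
  show "p \<in> mpolys_le (Max (monom_degree ` Poly_Mapping.keys p))"
    by (simp add: mpolys_le_def)
qed

lemma keys_subset_add: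
  assumes "Poly_Mapping.keys p \<subseteq> S" "Poly_Mapping.keys q \<subseteq> S"
  shows "Poly_Mapping.keys (p + q) \<subseteq> S"
  using assms keys_add[of p q] by blast

lemma keys_subset_scale:
  assumes "Poly_Mapping.keys p \<subseteq> S"
  shows "Poly_Mapping.keys (mpoly_scale c p) \<subseteq> S"
  using assms by (auto simp: in_keys_iff lookup_mpoly_scale)

lemma subspace_keys_subset: "mpoly.subspace {p. Poly_Mapping.keys p \<subseteq> S}"
  unfolding mpoly.subspace_def
  by (simp add: keys_subset_add keys_subset_scale)

subsection \<open>Leading monomials\<close>

text \<open>The total degree sits at the most significant position of the library's lexicographic order on
  \<open>nat \<Rightarrow>\<^sub>0 nat\<close>, so the pulled back monomial order is graded.\<close>

definition grlex_key :: "('v::finite \<Rightarrow>\<^sub>0 nat) \<Rightarrow> (nat \<Rightarrow>\<^sub>0 nat)" where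
  "grlex_key \<alpha> = Poly_Mapping.single 0 (monom_degree \<alpha>) +
     (\<Sum>v\<in>UNIV. Poly_Mapping.single (Suc (to_nat v)) (Poly_Mapping.lookup \<alpha> v))"

lemma grlex_key_add: "grlex_key (\<alpha> + \<beta>) = grlex_key \<alpha> + grlex_key \<beta>"
  by (simp add: grlex_key_def monom_degree_add lookup_add single_add sum.distrib add_ac)

lemma lookup_grlex_key:
  "Poly_Mapping.lookup (grlex_key \<alpha>) 0 = monom_degree \<alpha>"
  "Poly_Mapping.lookup (grlex_key \<alpha>) (Suc (to_nat v)) = Poly_Mapping.lookup \<alpha> v"
  by (simp_all add: grlex_key_def lookup_add lookup_sum lookup_single when_def)

text \<open>Each exponent is stored at its own position \<open>Suc (to_nat v)\<close>. Hence
  distinct monomials never tie, and a nonzero polynomial has exactly one leading monomial.\<close>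

lemma inj_grlex_key: "inj grlex_key"
proof (rule injI, rule poly_mapping_eqI)
  fix \<alpha> \<beta> :: "'v::finite \<Rightarrow>\<^sub>0 nat" and v
  assume "grlex_key \<alpha> = grlex_key \<beta>"
  then show "Poly_Mapping.lookup \<alpha> v = Poly_Mapping.lookup \<beta> v"
    by (metis lookup_grlex_key(2))
qed

text \<open>The first position where the keys differ is either 0, which stores the degrees, or a
  later one, and then the degrees agree.\<close>

lemma monom_degree_mono_grlex_key:
  assumes "grlex_key \<alpha> \<le> grlex_key \<beta>"
  shows "monom_degree \<alpha> \<le> monom_degree \<beta>"
proof (cases "grlex_key \<alpha> = grlex_key \<beta>")
  case True
  then show ?thesis by (metis lookup_grlex_key(1) order_refl)
next
  case False
  then have "grlex_key \<alpha> < grlex_key \<beta>" using assms by simp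
  then obtain k where "Poly_Mapping.lookup (grlex_key \<alpha>) k < Poly_Mapping.lookup (grlex_key \<beta>) k"
    "\<forall>k'<k. Poly_Mapping.lookup (grlex_key \<alpha>) k' = Poly_Mapping.lookup (grlex_key \<beta>) k'"
    by (auto simp: less_poly_mapping.rep_eq less_fun_def)
  then show ?thesis
    by (metis lookup_grlex_key(1) less_imp_le order_refl neq0_conv)
qed

text \<open>The order is supplied by a key into a linear order, so that one theory serves both
  affine monomials and monomials of forms, the latter compared after dehomogenization. The key has
  to be injective only on the finite set of exponents under consideration.\<close>

definition leads :: "('b \<Rightarrow> 'k::linorder) \<Rightarrow> ('b \<Rightarrow>\<^sub>0 'a::zero) set \<Rightarrow> 'b set" where
  "leads \<kappa> V = {\<alpha>. \<exists>p\<in>V. \<alpha> \<in> Poly_Mapping.keys p \<and> (\<forall>\<beta>\<in>Poly_Mapping.keys p. \<kappa> \<beta> \<le> \<kappa> \<alpha>)}"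

lemma finite_argmax:
  fixes \<kappa> :: "'b \<Rightarrow> 'k::linorder"
  assumes "finite A" "A \<noteq> {}"
  obtains a where "a \<in> A" "\<And>b. b \<in> A \<Longrightarrow> \<kappa> b \<le> \<kappa> a"
proof -
  have "Max (\<kappa> ` A) \<in> \<kappa> ` A" using assms by (intro Max_in) auto
  then obtain a where "a \<in> A" "\<kappa> a = Max (\<kappa> ` A)" by auto
  then show ?thesis using that assms by simp
qed

lemma obtain_lead:
  fixes \<kappa> :: "'b \<Rightarrow> 'k::linorder"
  assumes "p \<in> V" "p \<noteq> 0"
  obtains \<alpha> where "\<alpha> \<in> Poly_Mapping.keys p" "\<alpha> \<in> leads \<kappa> V"
proof -
  have "Poly_Mapping.keys p \<noteq> {}" using assms(2) by simp
  then obtain \<alpha> where "\<alpha> \<in> Poly_Mapping.keys p" "\<And>\<beta>. \<beta> \<in> Poly_Mapping.keys p \<Longrightarrow> \<kappa> \<beta> \<le> \<kappa> \<alpha>"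
    using finite_argmax[of "Poly_Mapping.keys p" \<kappa>] by auto
  then show ?thesis using that assms(1) unfolding leads_def by blast
qed

text \<open>Division with remainder: the largest exponent of \<open>p\<close> in \<open>L\<close> is
  cancelled by a multiple of the corresponding \<open>f \<alpha>\<close>, which creates only smaller
  exponents in \<open>L\<close>.\<close>

lemma leads_reduce:
  fixes f :: "('v \<Rightarrow>\<^sub>0 nat) \<Rightarrow> ('v, 'a::field) mpoly" and \<kappa> :: "_ \<Rightarrow> 'k::linorder"
  assumes S: "finite S" "inj_on \<kappa> S" and L: "L \<subseteq> S"
    and f: "\<And>\<alpha>. \<alpha> \<in> L \<Longrightarrow> Poly_Mapping.keys (f \<alpha>) \<subseteq> S"
      "\<And>\<alpha>. \<alpha> \<in> L \<Longrightarrow> \<alpha> \<in> Poly_Mapping.keys (f \<alpha>)"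
      "\<And>\<alpha> \<beta>. \<alpha> \<in> L \<Longrightarrow> \<beta> \<in> Poly_Mapping.keys (f \<alpha>) \<Longrightarrow> \<kappa> \<beta> \<le> \<kappa> \<alpha>"
    and p: "Poly_Mapping.keys p \<subseteq> S"
  shows "\<exists>r. p - r \<in> mpoly.span (f ` L) \<and> Poly_Mapping.keys r \<subseteq> S - L"
  using p
\<comment> \<open>The measure counts the exponents of \<open>S\<close> at or below some reducible
  exponent of \<open>p\<close>. Finiteness of \<open>S\<close> thus takes the place of
  well-foundedness of the order.\<close>
proof (induction "card {\<beta>\<in>S. \<exists>\<alpha>\<in>Poly_Mapping.keys p \<inter> L. \<kappa> \<beta> \<le> \<kappa> \<alpha>}" arbitrary: p rule: less_induct)
  case less
  show ?case
  proof (cases "Poly_Mapping.keys p \<inter> L = {}")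
    case True
    then show ?thesis using less.prems by (intro exI[of _ p]) (auto simp: mpoly.span_zero)
  next
    case False
    then obtain \<alpha> where \<alpha>: "\<alpha> \<in> Poly_Mapping.keys p \<inter> L"
        "\<And>\<beta>. \<beta> \<in> Poly_Mapping.keys p \<inter> L \<Longrightarrow> \<kappa> \<beta> \<le> \<kappa> \<alpha>"
      using finite_argmax[of "Poly_Mapping.keys p \<inter> L" \<kappa>] by auto
    define c where "c = Poly_Mapping.lookup p \<alpha> / Poly_Mapping.lookup (f \<alpha>) \<alpha>"
    define q where "q = p - mpoly_scale c (f \<alpha>)"
    have nz: "Poly_Mapping.lookup (f \<alpha>) \<alpha> \<noteq> 0" using f(2) \<alpha>(1) by (auto simp: in_keys_iff)
    have q\<alpha>: "Poly_Mapping.lookup q \<alpha> = 0"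
      using nz by (simp add: q_def c_def lookup_minus lookup_mpoly_scale)
    have kq: "Poly_Mapping.keys q \<subseteq> Poly_Mapping.keys p \<union> Poly_Mapping.keys (f \<alpha>)"
      by (auto simp: q_def in_keys_iff lookup_minus lookup_mpoly_scale)
    have qS: "Poly_Mapping.keys q \<subseteq> S" using kq less.prems f(1) \<alpha>(1) by blast
    \<comment> \<open>Reducible exponents of \<open>p\<close> and all exponents of
      \<open>f \<alpha>\<close> are bounded by \<open>\<alpha>\<close>, and the coefficient at
      \<open>\<alpha>\<close> itself has been cancelled.\<close>
    have lt: "\<kappa> \<beta> < \<kappa> \<alpha>" if "\<beta> \<in> Poly_Mapping.keys q \<inter> L" for \<beta>
    proof -
      have "\<kappa> \<beta> \<le> \<kappa> \<alpha>" using that kq \<alpha> f(3) by blast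
      moreover have "\<beta> \<noteq> \<alpha>" using q\<alpha> that by (auto simp: in_keys_iff)
      then have "\<kappa> \<beta> \<noteq> \<kappa> \<alpha>" using S(2) that L \<alpha>(1) by (auto dest: inj_onD)
      ultimately show ?thesis by simp
    qed
    have "{\<beta>\<in>S. \<exists>\<alpha>\<in>Poly_Mapping.keys q \<inter> L. \<kappa> \<beta> \<le> \<kappa> \<alpha>} \<subset>
        {\<beta>\<in>S. \<exists>\<alpha>\<in>Poly_Mapping.keys p \<inter> L. \<kappa> \<beta> \<le> \<kappa> \<alpha>}"
    proof (rule psubsetI)
      show "{\<beta>\<in>S. \<exists>\<alpha>\<in>Poly_Mapping.keys q \<inter> L. \<kappa> \<beta> \<le> \<kappa> \<alpha>} \<subseteq>
        {\<beta>\<in>S. \<exists>\<alpha>\<in>Poly_Mapping.keys p \<inter> L. \<kappa> \<beta> \<le> \<kappa> \<alpha>}"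
        using lt \<alpha>(1) by (blast intro: order_trans less_imp_le)
      have "\<alpha> \<in> {\<beta>\<in>S. \<exists>\<alpha>\<in>Poly_Mapping.keys p \<inter> L. \<kappa> \<beta> \<le> \<kappa> \<alpha>}" using \<alpha>(1) L by blast
      moreover have "\<alpha> \<notin> {\<beta>\<in>S. \<exists>\<alpha>\<in>Poly_Mapping.keys q \<inter> L. \<kappa> \<beta> \<le> \<kappa> \<alpha>}"
        using lt by (auto simp: not_le)
      ultimately show "{\<beta>\<in>S. \<exists>\<alpha>\<in>Poly_Mapping.keys q \<inter> L. \<kappa> \<beta> \<le> \<kappa> \<alpha>} \<noteq>
        {\<beta>\<in>S. \<exists>\<alpha>\<in>Poly_Mapping.keys p \<inter> L. \<kappa> \<beta> \<le> \<kappa> \<alpha>}" by blast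
    qed
    then have "card {\<beta>\<in>S. \<exists>\<alpha>\<in>Poly_Mapping.keys q \<inter> L. \<kappa> \<beta> \<le> \<kappa> \<alpha>} <
        card {\<beta>\<in>S. \<exists>\<alpha>\<in>Poly_Mapping.keys p \<inter> L. \<kappa> \<beta> \<le> \<kappa> \<alpha>}"
      using S(1) by (intro psubset_card_mono) auto
    from less.hyps[OF this qS] obtain r where r: "q - r \<in> mpoly.span (f ` L)"
      "Poly_Mapping.keys r \<subseteq> S - L" by blast
    have "mpoly_scale c (f \<alpha>) \<in> mpoly.span (f ` L)"
      using \<alpha>(1) by (auto intro: mpoly.span_scale mpoly.span_base)
    with r(1) have "(q - r) + mpoly_scale c (f \<alpha>) \<in> mpoly.span (f ` L)" by (rule mpoly.span_add)
    then have "p - r \<in> mpoly.span (f ` L)" by (simp add: q_def algebra_simps)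
    with r(2) show ?thesis by blast
  qed
qed

lemma leads_choice:
  fixes V :: "('v, 'a::field) mpoly set" and \<kappa> :: "_ \<Rightarrow> 'k::linorder"
  obtains f where "\<And>\<alpha>. \<alpha> \<in> leads \<kappa> V \<Longrightarrow> f \<alpha> \<in> V"
    "\<And>\<alpha>. \<alpha> \<in> leads \<kappa> V \<Longrightarrow> \<alpha> \<in> Poly_Mapping.keys (f \<alpha>)"
    "\<And>\<alpha> \<beta>. \<alpha> \<in> leads \<kappa> V \<Longrightarrow> \<beta> \<in> Poly_Mapping.keys (f \<alpha>) \<Longrightarrow> \<kappa> \<beta> \<le> \<kappa> \<alpha>"
proof -
  have "\<forall>\<alpha>\<in>leads \<kappa> V. \<exists>p. p \<in> V \<and> \<alpha> \<in> Poly_Mapping.keys p \<and> (\<forall>\<beta>\<in>Poly_Mapping.keys p. \<kappa> \<beta> \<le> \<kappa> \<alpha>)"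
    unfolding leads_def by blast
  then obtain f where "\<forall>\<alpha>\<in>leads \<kappa> V. f \<alpha> \<in> V \<and> \<alpha> \<in> Poly_Mapping.keys (f \<alpha>) \<and>
      (\<forall>\<beta>\<in>Poly_Mapping.keys (f \<alpha>). \<kappa> \<beta> \<le> \<kappa> \<alpha>)"
    unfolding bchoice_iff by blast
  then show ?thesis using that by blast
qed

text \<open>The divisors are taken from the subspace \<open>V\<close>, so reduction changes
  \<open>p\<close> only modulo \<open>V\<close>: the monomials that are not leading span everything
  modulo \<open>V\<close>.\<close>

lemma normal_form_exists:
  fixes V :: "('v, 'a::field) mpoly set" and \<kappa> :: "_ \<Rightarrow> 'k::linorder"
  assumes V: "mpoly.subspace V" "\<And>p. p \<in> V \<Longrightarrow> Poly_Mapping.keys p \<subseteq> S"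
    and S: "finite S" "inj_on \<kappa> S" and p: "Poly_Mapping.keys p \<subseteq> S"
  shows "\<exists>r. p - r \<in> V \<and> Poly_Mapping.keys r \<subseteq> S - leads \<kappa> V"
proof -
  obtain f where f: "\<And>\<alpha>. \<alpha> \<in> leads \<kappa> V \<Longrightarrow> f \<alpha> \<in> V"
    "\<And>\<alpha>. \<alpha> \<in> leads \<kappa> V \<Longrightarrow> \<alpha> \<in> Poly_Mapping.keys (f \<alpha>)"
    "\<And>\<alpha> \<beta>. \<alpha> \<in> leads \<kappa> V \<Longrightarrow> \<beta> \<in> Poly_Mapping.keys (f \<alpha>) \<Longrightarrow> \<kappa> \<beta> \<le> \<kappa> \<alpha>"
    using leads_choice[of \<kappa> V] by blast
  have "leads \<kappa> V \<subseteq> S" using V(2) unfolding leads_def by blast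
  then obtain r where "p - r \<in> mpoly.span (f ` leads \<kappa> V)" "Poly_Mapping.keys r \<subseteq> S - leads \<kappa> V"
    using leads_reduce[OF S, of "leads \<kappa> V" f p] f V(2) p by blast
  moreover have "mpoly.span (f ` leads \<kappa> V) \<subseteq> V"
    by (rule mpoly.span_minimal) (use f(1) V(1) in auto)
  ultimately show ?thesis by blast
qed

text \<open>One element of \<open>V\<close> per leading monomial gives a basis in echelon form. It
  spans because the remainder of an element of \<open>V\<close> lies in \<open>V\<close> yet
  contains no leading monomial, hence is 0.\<close>

lemma dim_eq_card_leads:
  fixes V :: "('v, 'a::field) mpoly set" and \<kappa> :: "_ \<Rightarrow> 'k::linorder"
  assumes V: "mpoly.subspace V" "\<And>p. p \<in> V \<Longrightarrow> Poly_Mapping.keys p \<subseteq> S"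
    and S: "finite S" "inj_on \<kappa> S"
  shows "mpoly.dim V = card (leads \<kappa> V)"
proof -
  let ?L = "leads \<kappa> V"
  obtain f where f: "\<And>\<alpha>. \<alpha> \<in> ?L \<Longrightarrow> f \<alpha> \<in> V"
    "\<And>\<alpha>. \<alpha> \<in> ?L \<Longrightarrow> \<alpha> \<in> Poly_Mapping.keys (f \<alpha>)"
    "\<And>\<alpha> \<beta>. \<alpha> \<in> ?L \<Longrightarrow> \<beta> \<in> Poly_Mapping.keys (f \<alpha>) \<Longrightarrow> \<kappa> \<beta> \<le> \<kappa> \<alpha>"
    using leads_choice[of \<kappa> V] by blast
  have LS: "?L \<subseteq> S" using V(2) unfolding leads_def by blast
  then have finL: "finite ?L" using S(1) finite_subset by blast
  have inj\<kappa>: "\<alpha> = \<beta>" if "\<alpha> \<in> ?L" "\<beta> \<in> ?L" "\<kappa> \<alpha> = \<kappa> \<beta>" for \<alpha> \<beta>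
    using that S(2) LS by (auto dest: inj_onD)
  have inj: "inj_on f ?L"
    by (rule inj_onI) (metis f(2,3) inj\<kappa> order_antisym)
  have sub: "mpoly.span (f ` ?L) \<subseteq> V"
    by (rule mpoly.span_minimal) (use f(1) V(1) in auto)
  have "V \<subseteq> mpoly.span (f ` ?L)"
  proof
    fix p assume p: "p \<in> V"
    obtain r where r: "p - r \<in> mpoly.span (f ` ?L)" "Poly_Mapping.keys r \<subseteq> S - ?L"
      using leads_reduce[OF S LS, of f p] f V(2) p by blast
    have "r \<in> V" using mpoly.subspace_diff[OF V(1) p, of "p - r"] r(1) sub by auto
    then have "r = 0" using obtain_lead[of r V \<kappa>] r(2) by blast
    with r(1) show "p \<in> mpoly.span (f ` ?L)" by simp
  qed
  then have span: "mpoly.span (f ` ?L) = mpoly.span V"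
    using sub V(1) mpoly.span_eq_iff[of V] by (metis subset_antisym)
  have "mpoly.independent (f ` ?L)"
  proof (rule notI)
    assume "mpoly.dependent (f ` ?L)"
    then obtain u where u: "\<exists>v\<in>f ` ?L. u v \<noteq> 0" "(\<Sum>v\<in>f ` ?L. mpoly_scale (u v) v) = 0"
      using finL by (auto simp: mpoly.dependent_finite)
    \<comment> \<open>In a linear relation, take the largest leading monomial with nonzero
      coefficient: no other term of the relation contributes to it.\<close>
    let ?A = "{\<alpha>\<in>?L. u (f \<alpha>) \<noteq> 0}"
    have "finite ?A" "?A \<noteq> {}" using finL u(1) by auto
    then obtain \<alpha> where \<alpha>: "\<alpha> \<in> ?A" "\<And>\<beta>. \<beta> \<in> ?A \<Longrightarrow> \<kappa> \<beta> \<le> \<kappa> \<alpha>"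
      using finite_argmax[of ?A \<kappa>] by blast
    have "0 = Poly_Mapping.lookup (\<Sum>v\<in>f ` ?L. mpoly_scale (u v) v) \<alpha>" using u(2) by simp
    also have "\<dots> = (\<Sum>\<beta>\<in>?L. u (f \<beta>) * Poly_Mapping.lookup (f \<beta>) \<alpha>)"
      by (simp add: sum.reindex[OF inj] lookup_sum lookup_mpoly_scale)
    also have "\<dots> = (\<Sum>\<beta>\<in>?L. if \<beta> = \<alpha> then u (f \<alpha>) * Poly_Mapping.lookup (f \<alpha>) \<alpha> else 0)"
    proof (rule sum.cong[OF refl])
      fix \<beta> assume \<beta>: "\<beta> \<in> ?L"
      show "u (f \<beta>) * Poly_Mapping.lookup (f \<beta>) \<alpha> =
          (if \<beta> = \<alpha> then u (f \<alpha>) * Poly_Mapping.lookup (f \<alpha>) \<alpha> else 0)"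
      proof (cases "\<beta> = \<alpha> \<or> u (f \<beta>) = 0 \<or> Poly_Mapping.lookup (f \<beta>) \<alpha> = 0")
        case False
        then have "\<kappa> \<beta> \<le> \<kappa> \<alpha>" "\<kappa> \<alpha> \<le> \<kappa> \<beta>" using \<alpha>(2) \<beta> f(3) by (auto simp: in_keys_iff)
        then have "\<beta> = \<alpha>" using inj\<kappa> \<beta> \<alpha>(1) by auto
        then show ?thesis using False by blast
      qed auto
    qed
    also have "\<dots> = u (f \<alpha>) * Poly_Mapping.lookup (f \<alpha>) \<alpha>" using finL \<alpha>(1) by simp
    finally show False using \<alpha>(1) f(2) by (auto simp: in_keys_iff)
  qed
  then have "mpoly.dim V = card (f ` ?L)" using span by (metis mpoly.dim_eq_card)
  then show ?thesis by (simp add: card_image inj)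
qed

subsection \<open>The Hilbert function counts standard monomials\<close>

text \<open>Exponents and coefficients are transformed together, and coefficients with the same
  image exponent are added. Multiplication by a monomial, homogenization, real and imaginary parts
  of dehomogenized forms and renaming of variables are all instances.\<close>

definition reindex :: "('b \<Rightarrow> 'c) \<Rightarrow> ('a \<Rightarrow> 'e) \<Rightarrow> ('b \<Rightarrow>\<^sub>0 'a::zero) \<Rightarrow> ('c \<Rightarrow>\<^sub>0 'e::comm_monoid_add)" where
  "reindex \<phi> c p = (\<Sum>\<alpha>\<in>Poly_Mapping.keys p. Poly_Mapping.single (\<phi> \<alpha>) (c (Poly_Mapping.lookup p \<alpha>)))"

lemma lookup_reindex:
  assumes "inj_on \<phi> (Poly_Mapping.keys p)" "\<alpha> \<in> Poly_Mapping.keys p"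
  shows "Poly_Mapping.lookup (reindex \<phi> c p) (\<phi> \<alpha>) = c (Poly_Mapping.lookup p \<alpha>)"
proof -
  have "Poly_Mapping.lookup (reindex \<phi> c p) (\<phi> \<alpha>) =
      (\<Sum>\<beta>\<in>Poly_Mapping.keys p. if \<beta> = \<alpha> then c (Poly_Mapping.lookup p \<alpha>) else 0)"
    unfolding reindex_def lookup_sum lookup_single when_def
    by (rule sum.cong) (use assms in \<open>auto dest: inj_onD\<close>)
  then show ?thesis using assms(2) by simp
qed

lemma keys_reindex: "Poly_Mapping.keys (reindex \<phi> c p) \<subseteq> \<phi> ` Poly_Mapping.keys p"
  unfolding reindex_def
  by (rule order_trans[OF keys_sum]) auto

lemma mpoly_eval_reindex:
  "mpoly_eval (reindex \<phi> c p) x =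
    (\<Sum>\<alpha>\<in>Poly_Mapping.keys p. c (Poly_Mapping.lookup p \<alpha>) * monom_eval (\<phi> \<alpha>) x)"
  by (simp add: reindex_def mpoly_eval_sum)

section \<open>The vanishing ideal of a real set and its standard monomials\<close>

definition vanishing_ideal :: "(real ^ 'n::finite) set \<Rightarrow> ('n, real) mpoly set" where
  "vanishing_ideal \<gamma> = {p. \<forall>x\<in>\<gamma>. mpoly_eval p (\<lambda>i. x $ i) = 0}"

abbreviation lead_monoms :: "(real ^ 'n::finite) set \<Rightarrow> ('n \<Rightarrow>\<^sub>0 nat) set" where
  "lead_monoms \<gamma> \<equiv> leads grlex_key (vanishing_ideal \<gamma>)"

text \<open>By reduction these monomials span the polynomial functions of degree at most
  \<open>m\<close> on \<open>\<gamma>\<close>, and a nonzero combination of them cannot vanish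
  there.\<close>

definition std_monoms :: "(real ^ 'n::finite) set \<Rightarrow> nat \<Rightarrow> ('n \<Rightarrow>\<^sub>0 nat) set" where
  "std_monoms \<gamma> m = {\<alpha>. monom_degree \<alpha> \<le> m \<and> \<alpha> \<notin> lead_monoms \<gamma>}"

text \<open>The order is graded, so a polynomial has degree at most \<open>m\<close> as soon as its
  leading monomial does.\<close>

lemma leads_vanishing_ideal_le:
  "leads grlex_key (vanishing_ideal \<gamma> \<inter> mpolys_le m) = {\<alpha>\<in>lead_monoms \<gamma>. monom_degree \<alpha> \<le> m}"
  unfolding leads_def mpolys_le_def
  by (auto dest: monom_degree_mono_grlex_key intro: order_trans)

lemma lead_monoms_add:
  assumes "\<alpha> \<in> lead_monoms \<gamma>"
  shows "\<alpha> + \<delta> \<in> lead_monoms \<gamma>"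
proof -
  obtain p where p: "p \<in> vanishing_ideal \<gamma>" "\<alpha> \<in> Poly_Mapping.keys p"
    "\<forall>\<beta>\<in>Poly_Mapping.keys p. grlex_key \<beta> \<le> grlex_key \<alpha>"
    using assms by (auto simp: leads_def)
  \<comment> \<open>This is \<open>p\<close> times the monomial \<open>\<delta>\<close>; the key is
    additive, so the leading monomial is shifted by \<open>\<delta>\<close>.\<close>
  define q where "q = reindex (\<lambda>\<beta>. \<beta> + \<delta>) (\<lambda>c. c) p"
  have "q \<in> vanishing_ideal \<gamma>"
  proof -
    have "mpoly_eval q x = mpoly_eval p x * monom_eval \<delta> x" for x
      unfolding q_def mpoly_eval_reindex by (simp add: monom_eval_add mpoly_eval_def sum_distrib_left mult_ac)
    then show ?thesis using p(1) by (simp add: vanishing_ideal_def)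
  qed
  moreover have "\<alpha> + \<delta> \<in> Poly_Mapping.keys q"
    using lookup_reindex[of "\<lambda>\<beta>. \<beta> + \<delta>" p \<alpha> "\<lambda>c. c"] p(2) by (simp add: q_def in_keys_iff inj_on_def)
  moreover have "\<forall>\<beta>\<in>Poly_Mapping.keys q. grlex_key \<beta> \<le> grlex_key (\<alpha> + \<delta>)"
    using keys_reindex[of "\<lambda>\<beta>. \<beta> + \<delta>" "\<lambda>c. c" p] p(3)
    by (auto simp: q_def grlex_key_add intro!: add_right_mono)
  ultimately show ?thesis by (auto simp: leads_def)
qed

section \<open>Homogenization and forms vanishing on the projective closure\<close>

definition dehomogenize :: "('n::finite option \<Rightarrow>\<^sub>0 nat) \<Rightarrow> ('n \<Rightarrow>\<^sub>0 nat)" where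
  "dehomogenize \<beta> = Abs_poly_mapping (\<lambda>i. Poly_Mapping.lookup \<beta> (Some i))"

text \<open>The missing degree is given to the homogenizing coordinate. The result has degree
  \<open>m\<close> only if \<open>monom_degree \<alpha>\<close> is at most \<open>m\<close>, since
  the subtraction truncates.\<close>

definition homogenize :: "nat \<Rightarrow> ('n::finite \<Rightarrow>\<^sub>0 nat) \<Rightarrow> ('n option \<Rightarrow>\<^sub>0 nat)" where
  "homogenize m \<alpha> = Abs_poly_mapping (case_option (m - monom_degree \<alpha>) (Poly_Mapping.lookup \<alpha>))"

lemma lookup_dehomogenize [simp]: "Poly_Mapping.lookup (dehomogenize \<beta>) i = Poly_Mapping.lookup \<beta> (Some i)"
  by (simp add: dehomogenize_def)

lemma lookup_homogenize [simp]:
  "Poly_Mapping.lookup (homogenize m \<alpha>) None = m - monom_degree \<alpha>"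
  "Poly_Mapping.lookup (homogenize m \<alpha>) (Some i) = Poly_Mapping.lookup \<alpha> i"
  by (simp_all add: homogenize_def)

lemma dehom_hom [simp]: "dehomogenize (homogenize m \<alpha>) = \<alpha>"
  by (rule poly_mapping_eqI) simp

lemma sum_option: "sum f (UNIV :: 'n::finite option set) = f None + (\<Sum>i\<in>UNIV. f (Some i))"
  by (simp add: UNIV_option_conv sum.reindex)

lemma prod_option: "prod f (UNIV :: 'n::finite option set) = f None * (\<Prod>i\<in>UNIV. f (Some i))"
  by (simp add: UNIV_option_conv prod.reindex)

lemma monom_degree_option:
  "monom_degree (\<beta> :: 'n::finite option \<Rightarrow>\<^sub>0 nat) = Poly_Mapping.lookup \<beta> None + monom_degree (dehomogenize \<beta>)"
  by (simp add: monom_degree_UNIV sum_option)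

lemma monom_degree_hom: "monom_degree \<alpha> \<le> m \<Longrightarrow> monom_degree (homogenize m \<alpha>) = m"
  by (simp add: monom_degree_option)

lemma hom_dehom: "monom_degree \<beta> = m \<Longrightarrow> homogenize m (dehomogenize \<beta>) = \<beta>"
proof (rule poly_mapping_eqI)
  fix i assume "monom_degree \<beta> = m"
  then show "Poly_Mapping.lookup (homogenize m (dehomogenize \<beta>)) i = Poly_Mapping.lookup \<beta> i"
    by (cases i) (simp_all add: monom_degree_option)
qed

lemma bij_betw_dehom:
  "bij_betw dehomogenize {\<beta>. monom_degree \<beta> = m} {\<alpha> :: 'n::finite \<Rightarrow>\<^sub>0 nat. monom_degree \<alpha> \<le> m}"
  by (rule bij_betwI[where g = "homogenize m"])
     (auto simp: hom_dehom monom_degree_hom monom_degree_option[symmetric], simp add: monom_degree_option)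

lemma inj_on_dehom: "inj_on dehomogenize {\<beta>. monom_degree \<beta> = m}"
  using bij_betw_dehom by (rule bij_betw_imp_inj_on)

text \<open>A fixed representative of \<open>proj_embed x\<close>, which turns vanishing at a
  projective point into evaluation at one vector.\<close>

definition affine_coords :: "real ^ 'n::finite \<Rightarrow> complex ^ 'n option" where
  "affine_coords x = (\<chi> i. case i of None \<Rightarrow> 1 | Some j \<Rightarrow> complex_of_real (x $ j))"

lemma proj_embed_eq: "proj_embed x = proj_class (affine_coords x)"
  by (simp add: proj_embed_def affine_coords_def)

lemma monom_eval_affine_coords:
  "monom_eval \<beta> (\<lambda>i. affine_coords x $ i) = of_real (monom_eval (dehomogenize \<beta>) (\<lambda>i. x $ i))"
  by (simp add: monom_eval_UNIV prod_option affine_coords_def)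

text \<open>Rescaling the coordinates by \<open>c\<close> multiplies a form of degree
  \<open>m\<close> by \<open>c ^ m\<close>, so a single representative decides.\<close>

lemma vanishes_at_proj_class:
  assumes "F \<in> homogeneous m"
  shows "vanishes_at F (proj_class z) \<longleftrightarrow> mpoly_eval F (\<lambda>i. z $ i) = 0"
proof -
  have ev: "mpoly_eval F (\<lambda>i. (c *s z) $ i) = c ^ m * mpoly_eval F (\<lambda>i. z $ i)" for c
  proof -
    have "monom_eval \<beta> (\<lambda>i. (c *s z) $ i) = c ^ m * monom_eval \<beta> (\<lambda>i. z $ i)"
      if "\<beta> \<in> Poly_Mapping.keys F" for \<beta>
    proof -
      have "m = (\<Sum>v\<in>UNIV. Poly_Mapping.lookup \<beta> v)"
        using assms that by (simp add: homogeneous_def monom_degree_UNIV)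
      then show ?thesis
        by (simp add: monom_eval_UNIV power_mult_distrib prod.distrib power_sum)
    qed
    then show ?thesis
      by (simp add: mpoly_eval_def sum_distrib_left mult_ac)
  qed
  show ?thesis
  proof
    assume v: "vanishes_at F (proj_class z)"
    have "z \<in> proj_class z" unfolding proj_class_def by (auto intro!: exI[of _ 1])
    then show "mpoly_eval F (\<lambda>i. z $ i) = 0" using v by (auto simp: vanishes_at_def)
  next
    assume "mpoly_eval F (\<lambda>i. z $ i) = 0"
    then show "vanishes_at F (proj_class z)"
      using ev by (auto simp: vanishes_at_def proj_class_def simp del: vector_smult_component)
  qed
qed

text \<open>The zero set of a form vanishing on \<open>S\<close> is a projective algebraic set
  containing \<open>S\<close>, hence it contains the closure.\<close>

lemma vanishing_forms_zariski_closure: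
  assumes "S \<subseteq> proj_space"
  shows "vanishing_forms (zariski_closure S) m = {F \<in> homogeneous m. \<forall>P\<in>S. vanishes_at F P}"
proof -
  have "S \<subseteq> zariski_closure S" by (auto simp: zariski_closure_def)
  moreover have "\<forall>P\<in>zariski_closure S. vanishes_at F P"
    if F: "F \<in> homogeneous m" "\<forall>P\<in>S. vanishes_at F P" for F
  proof -
    have "proj_algebraic {P \<in> proj_space. \<forall>F\<in>{F}. vanishes_at F P}"
      unfolding proj_algebraic_def by (rule exI[of _ "{F}"]) (use F(1) in blast)
    moreover have "S \<subseteq> {P \<in> proj_space. \<forall>F\<in>{F}. vanishes_at F P}" using assms F(2) by auto
    ultimately show ?thesis by (auto simp: zariski_closure_def)
  qed
  ultimately show ?thesis unfolding vanishing_forms_def by blast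
qed

lemma vanishing_forms_curve:
  "vanishing_forms (zariski_closure (proj_embed ` \<gamma>)) m =
    {F \<in> homogeneous m. \<forall>x\<in>\<gamma>. mpoly_eval F (\<lambda>i. affine_coords x $ i) = 0}"
proof -
  have "affine_coords x \<noteq> 0" for x :: "real ^ 'n"
  proof
    assume "affine_coords x = 0"
    then have "affine_coords x $ None = 0" by simp
    then show False by (simp add: affine_coords_def)
  qed
  then have "proj_embed ` \<gamma> \<subseteq> proj_space" by (auto simp: proj_embed_eq proj_space_def)
  then show ?thesis
    by (auto simp: vanishing_forms_zariski_closure proj_embed_eq vanishes_at_proj_class)
qed

lemma subspace_homogeneous: "mpoly.subspace (homogeneous m)"
  using subspace_keys_subset[of "{\<alpha>. monom_degree \<alpha> = m}"]
  by (simp add: homogeneous_def subset_iff Ball_def)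

text \<open>A complex form vanishes on a real set iff its real and imaginary parts do, so the complex
  homogeneous leading monomials are those of the real affine ideal.\<close>

lemma leads_vanishing_forms:
  fixes \<gamma> :: "(real ^ 'n::finite) set"
  shows "dehomogenize ` leads (\<lambda>\<beta>. grlex_key (dehomogenize \<beta>)) (vanishing_forms (zariski_closure (proj_embed ` \<gamma>)) m) =
    {\<alpha>\<in>lead_monoms \<gamma>. monom_degree \<alpha> \<le> m}"
    (is "dehomogenize ` leads ?\<kappa> ?W = ?R")
proof
  show "dehomogenize ` leads ?\<kappa> ?W \<subseteq> ?R"
  proof
    fix \<alpha> assume "\<alpha> \<in> dehomogenize ` leads ?\<kappa> ?W"
    then obtain \<beta> F where \<beta>: "\<alpha> = dehomogenize \<beta>" "\<beta> \<in> Poly_Mapping.keys F"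
        "\<forall>\<beta>'\<in>Poly_Mapping.keys F. ?\<kappa> \<beta>' \<le> ?\<kappa> \<beta>"
      and F: "F \<in> homogeneous m" "\<forall>x\<in>\<gamma>. mpoly_eval F (\<lambda>i. affine_coords x $ i) = 0"
      by (auto simp: leads_def vanishing_forms_curve)
    have inj: "inj_on dehomogenize (Poly_Mapping.keys F)"
      by (rule inj_on_subset[OF inj_on_dehom[of m]]) (use F(1) in \<open>auto simp: homogeneous_def\<close>)
    have deg: "monom_degree \<alpha> \<le> m"
      using \<beta>(1,2) F(1) monom_degree_option[of \<beta>] by (auto simp: homogeneous_def)
    have main: "\<alpha> \<in> lead_monoms \<gamma>"
      if c: "c (Poly_Mapping.lookup F \<beta>) \<noteq> 0" and van: "reindex dehomogenize c F \<in> vanishing_ideal \<gamma>"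
      for c :: "complex \<Rightarrow> real"
    proof -
      have "\<alpha> \<in> Poly_Mapping.keys (reindex dehomogenize c F)"
        using lookup_reindex[OF inj \<beta>(2), of c] c by (simp add: \<beta>(1) in_keys_iff)
      moreover have "\<forall>\<beta>'\<in>Poly_Mapping.keys (reindex dehomogenize c F). grlex_key \<beta>' \<le> grlex_key \<alpha>"
        using keys_reindex[of dehomogenize c F] \<beta>(1,3) by blast
      ultimately show ?thesis using van by (auto simp: leads_def)
    qed
    have Re: "reindex dehomogenize Re F \<in> vanishing_ideal \<gamma>"
    proof -
      have "mpoly_eval (reindex dehomogenize Re F) (\<lambda>i. x $ i) = Re (mpoly_eval F (\<lambda>i. affine_coords x $ i))" for x
        unfolding mpoly_eval_reindex by (simp add: mpoly_eval_def monom_eval_affine_coords)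
      then show ?thesis using F(2) by (simp add: vanishing_ideal_def)
    qed
    have Im: "reindex dehomogenize Im F \<in> vanishing_ideal \<gamma>"
    proof -
      have "mpoly_eval (reindex dehomogenize Im F) (\<lambda>i. x $ i) = Im (mpoly_eval F (\<lambda>i. affine_coords x $ i))" for x
        unfolding mpoly_eval_reindex by (simp add: mpoly_eval_def monom_eval_affine_coords)
      then show ?thesis using F(2) by (simp add: vanishing_ideal_def)
    qed
    have "Re (Poly_Mapping.lookup F \<beta>) \<noteq> 0 \<or> Im (Poly_Mapping.lookup F \<beta>) \<noteq> 0"
      using \<beta>(2) by (simp add: in_keys_iff complex_eq_iff)
    then show "\<alpha> \<in> ?R" using main[OF _ Re] main[OF _ Im] deg by blast
  qed
  show "?R \<subseteq> dehomogenize ` leads ?\<kappa> ?W"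
  proof
    fix \<alpha> assume \<alpha>: "\<alpha> \<in> ?R"
    then obtain p where p: "p \<in> vanishing_ideal \<gamma>" "\<alpha> \<in> Poly_Mapping.keys p"
      "\<forall>\<beta>\<in>Poly_Mapping.keys p. grlex_key \<beta> \<le> grlex_key \<alpha>"
      by (auto simp: leads_def)
    \<comment> \<open>Gradedness bounds every monomial of \<open>p\<close> by the degree of
      \<open>\<alpha>\<close>, so homogenizing to degree \<open>m\<close> really yields a
      form.\<close>
    have deg: "monom_degree \<beta> \<le> m" if "\<beta> \<in> Poly_Mapping.keys p" for \<beta>
      using monom_degree_mono_grlex_key[of \<beta> \<alpha>] p(3) that \<alpha> by auto
    define F where "F = reindex (homogenize m) complex_of_real p"
    have inj: "inj_on (homogenize m) (Poly_Mapping.keys p)" by (rule inj_onI) (metis dehom_hom)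
    have kF: "Poly_Mapping.keys F \<subseteq> homogenize m ` Poly_Mapping.keys p"
      unfolding F_def by (rule keys_reindex)
    have "F \<in> homogeneous m" using kF deg by (auto simp: homogeneous_def monom_degree_hom)
    moreover have "mpoly_eval F (\<lambda>i. affine_coords x $ i) = of_real (mpoly_eval p (\<lambda>i. x $ i))" for x
      unfolding F_def mpoly_eval_reindex by (simp add: mpoly_eval_def monom_eval_affine_coords)
    ultimately have "F \<in> ?W" using p(1) by (simp add: vanishing_forms_curve vanishing_ideal_def)
    moreover have "homogenize m \<alpha> \<in> Poly_Mapping.keys F"
      using lookup_reindex[OF inj p(2), of complex_of_real] p(2) by (simp add: F_def in_keys_iff)
    moreover have "\<forall>\<beta>\<in>Poly_Mapping.keys F. ?\<kappa> \<beta> \<le> ?\<kappa> (homogenize m \<alpha>)"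
      using kF p(3) by auto
    ultimately have "homogenize m \<alpha> \<in> leads ?\<kappa> ?W" by (auto simp: leads_def)
    then show "\<alpha> \<in> dehomogenize ` leads ?\<kappa> ?W" by (metis dehom_hom imageI)
  qed
qed

text \<open>Both dimensions are numbers of leading monomials. After dehomogenization these are all
  monomials of degree at most \<open>m\<close> and those of them that lead an element of the real
  ideal; the difference counts the standard ones.\<close>

lemma hilbert_function_eq_card_std_monoms:
  fixes \<gamma> :: "(real ^ 'n::finite) set"
  shows "hilbert_function (zariski_closure (proj_embed ` \<gamma>)) m = card (std_monoms \<gamma> m)"
proof -
  let ?\<kappa> = "\<lambda>\<beta> :: 'n option \<Rightarrow>\<^sub>0 nat. grlex_key (dehomogenize \<beta>)"
  let ?S = "{\<beta> :: 'n option \<Rightarrow>\<^sub>0 nat. monom_degree \<beta> = m}"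
  let ?H = "homogeneous m :: ('n option, complex) mpoly set"
  let ?W = "vanishing_forms (zariski_closure (proj_embed ` \<gamma>)) m"
  let ?R = "{\<alpha>\<in>lead_monoms \<gamma>. monom_degree \<alpha> \<le> m}"
  have fin: "finite ?S" by (rule finite_subset[OF _ finite_monom_degree_le[of m]]) auto
  have inj: "inj_on ?\<kappa> ?S"
    using inj_on_dehom[of m] inj_grlex_key by (auto simp: inj_on_def)
  have WH: "?W \<subseteq> ?H" by (auto simp: vanishing_forms_def)
  have "mpoly.dim ?H = card (leads ?\<kappa> ?H)"
    by (rule dim_eq_card_leads[OF subspace_homogeneous _ fin inj]) (auto simp: homogeneous_def)
  also have "leads ?\<kappa> ?H = ?S"
  proof
    show "leads ?\<kappa> ?H \<subseteq> ?S" by (auto simp: leads_def homogeneous_def)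
    show "?S \<subseteq> leads ?\<kappa> ?H"
    proof
      fix \<beta> assume "\<beta> \<in> ?S"
      then have "Poly_Mapping.single \<beta> 1 \<in> ?H" by (simp add: homogeneous_def)
      then show "\<beta> \<in> leads ?\<kappa> ?H" unfolding leads_def by force
    qed
  qed
  also have "card ?S = card {\<alpha> :: 'n \<Rightarrow>\<^sub>0 nat. monom_degree \<alpha> \<le> m}"
    by (rule bij_betw_same_card[OF bij_betw_dehom])
  finally have H: "mpoly.dim ?H = card {\<alpha> :: 'n \<Rightarrow>\<^sub>0 nat. monom_degree \<alpha> \<le> m}" .
  have sub: "mpoly.subspace ?H" by (rule subspace_homogeneous)
  have "mpoly.subspace ?W"
    unfolding mpoly.subspace_def vanishing_forms_curve
    using sub by (auto simp: mpoly.subspace_def mpoly_eval_add mpoly_eval_scale)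
  then have "mpoly.dim ?W = card (leads ?\<kappa> ?W)"
    by (rule dim_eq_card_leads[OF _ _ fin inj]) (use WH in \<open>auto simp: homogeneous_def\<close>)
  also have "\<dots> = card (dehomogenize ` leads ?\<kappa> ?W)"
  proof (rule card_image[symmetric], rule inj_on_subset[OF inj_on_dehom[of m]])
    show "leads ?\<kappa> ?W \<subseteq> ?S" using WH by (auto simp: leads_def homogeneous_def)
  qed
  finally have W: "mpoly.dim ?W = card ?R" by (simp only: leads_vanishing_forms)
  have "std_monoms \<gamma> m = {\<alpha>. monom_degree \<alpha> \<le> m} - ?R" by (auto simp: std_monoms_def)
  moreover have "?R \<subseteq> {\<alpha>. monom_degree \<alpha> \<le> m}" by auto
  moreover from this have "finite ?R" by (rule finite_subset) (rule finite_monom_degree_le)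
  ultimately have "card (std_monoms \<gamma> m) = card {\<alpha> :: 'n \<Rightarrow>\<^sub>0 nat. monom_degree \<alpha> \<le> m} - card ?R"
    by (simp add: card_Diff_subset)
  then show ?thesis using H W by (simp add: hilbert_function_def)
qed

subsection \<open>Linear growth of the Hilbert function\<close>

lemma lead_monoms_mono:
  assumes "\<alpha> \<in> lead_monoms \<gamma>" "\<And>v. Poly_Mapping.lookup \<alpha> v \<le> Poly_Mapping.lookup \<beta> v"
  shows "\<beta> \<in> lead_monoms \<gamma>"
proof -
  have "\<beta> = \<alpha> + (\<beta> - \<alpha>)"
    by (rule poly_mapping_eqI) (simp add: lookup_add lookup_minus assms(2))
  then show ?thesis using lead_monoms_add[OF assms(1)] by metis
qed

text \<open>Otherwise no monomial in the variables \<open>a\<close> and \<open>b\<close> alone is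
  leading, so no nonzero polynomial in these two variables vanishes on \<open>\<gamma>\<close>. Then
  the two coordinate functions are algebraically independent and the dimension is at least
  2.\<close>

lemma pair_monom_lead:
  fixes \<gamma> :: "(real ^ 'n::finite) set"
  assumes dim: "irreducible_dim \<gamma> = 1" and ab: "a \<noteq> b"
  shows "\<exists>K. Poly_Mapping.single a K + Poly_Mapping.single b K \<in> lead_monoms \<gamma>"
proof (rule ccontr)
  assume no: "\<nexists>K. Poly_Mapping.single a K + Poly_Mapping.single b K \<in> lead_monoms \<gamma>"
  define \<phi> where "\<phi> = (\<lambda>\<alpha> :: nat \<Rightarrow>\<^sub>0 nat. Poly_Mapping.single a (Poly_Mapping.lookup \<alpha> 0)
    + Poly_Mapping.single b (Poly_Mapping.lookup \<alpha> 1))"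
  have \<phi>: "\<phi> \<alpha> \<notin> lead_monoms \<gamma>" for \<alpha>
  proof
    \<comment> \<open>With this \<open>K\<close> the monomial \<open>\<phi> \<alpha>\<close> divides
      the \<open>K\<close>-th power of the product of the two variables.\<close>
    define K where "K = max (Poly_Mapping.lookup \<alpha> 0) (Poly_Mapping.lookup \<alpha> 1)"
    assume "\<phi> \<alpha> \<in> lead_monoms \<gamma>"
    then have "Poly_Mapping.single a K + Poly_Mapping.single b K \<in> lead_monoms \<gamma>"
      by (rule lead_monoms_mono) (use ab in \<open>auto simp: \<phi>_def K_def lookup_add lookup_single when_def\<close>)
    with no show False by blast
  qed
  define f :: "nat \<Rightarrow> ('n, real) mpoly" where
    "f = (\<lambda>k. Poly_Mapping.single (Poly_Mapping.single (if k = 0 then a else b) 1) 1)"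
  have "algebraically_independent_on \<gamma> 2 f"
    unfolding algebraically_independent_on_def
  proof (intro allI impI, elim conjE)
    fix Q :: "(nat, real) mpoly"
    assume vars: "mpoly_vars Q \<subseteq> {..<2}"
      and Q: "\<forall>x\<in>\<gamma>. mpoly_eval Q (\<lambda>j. mpoly_eval (f j) (\<lambda>i. x $ i)) = 0"
    have keys: "Poly_Mapping.keys \<alpha> \<subseteq> {..<2}" if "\<alpha> \<in> Poly_Mapping.keys Q" for \<alpha>
      using vars that by (auto simp: mpoly_vars_def)
    have lt2: "{..<2} = {0, 1::nat}" by auto
    \<comment> \<open>The map reads only the exponents of variables 0 and 1, so injectivity rests on
      \<open>Q\<close> having no other variables.\<close>
    have inj: "inj_on \<phi> (Poly_Mapping.keys Q)"
    proof (rule inj_onI, rule poly_mapping_eqI)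
      fix \<alpha> \<beta> i
      assume \<alpha>\<beta>: "\<alpha> \<in> Poly_Mapping.keys Q" "\<beta> \<in> Poly_Mapping.keys Q" and eq: "\<phi> \<alpha> = \<phi> \<beta>"
      have "Poly_Mapping.lookup (\<phi> \<alpha>) a = Poly_Mapping.lookup (\<phi> \<beta>) a"
        "Poly_Mapping.lookup (\<phi> \<alpha>) b = Poly_Mapping.lookup (\<phi> \<beta>) b" using eq by simp_all
      then have "Poly_Mapping.lookup \<alpha> 0 = Poly_Mapping.lookup \<beta> 0"
          "Poly_Mapping.lookup \<alpha> 1 = Poly_Mapping.lookup \<beta> 1"
        using ab by (simp_all add: \<phi>_def lookup_add lookup_single when_def)
      moreover have "i \<noteq> 0 \<Longrightarrow> i \<noteq> 1 \<Longrightarrow> i \<notin> Poly_Mapping.keys \<alpha>"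
          "i \<noteq> 0 \<Longrightarrow> i \<noteq> 1 \<Longrightarrow> i \<notin> Poly_Mapping.keys \<beta>"
        using keys[OF \<alpha>\<beta>(1)] keys[OF \<alpha>\<beta>(2)] by (auto simp: lt2)
      ultimately show "Poly_Mapping.lookup \<alpha> i = Poly_Mapping.lookup \<beta> i"
        by (cases "i = 0"; cases "i = 1") (simp_all add: in_keys_iff)
    qed
    define p where "p = reindex \<phi> (\<lambda>c. c) Q"
    have "mpoly_eval p (\<lambda>i. x $ i) = mpoly_eval Q (\<lambda>j. mpoly_eval (f j) (\<lambda>i. x $ i))" for x
      unfolding p_def mpoly_eval_reindex mpoly_eval_def[of Q]
    proof (rule sum.cong[OF refl])
      fix \<alpha> assume "\<alpha> \<in> Poly_Mapping.keys Q"
      then have "monom_eval \<alpha> (\<lambda>j. mpoly_eval (f j) (\<lambda>i. x $ i)) =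
          (\<Prod>j\<in>{0, 1}. mpoly_eval (f j) (\<lambda>i. x $ i) ^ Poly_Mapping.lookup \<alpha> j)"
        using keys lt2 by (intro monom_eval_superset) auto
      also have "\<dots> = monom_eval (\<phi> \<alpha>) (\<lambda>i. x $ i)"
        by (simp add: f_def \<phi>_def monom_eval_add)
      finally show "Poly_Mapping.lookup Q \<alpha> * monom_eval (\<phi> \<alpha>) (\<lambda>i. x $ i) =
          Poly_Mapping.lookup Q \<alpha> * monom_eval \<alpha> (\<lambda>j. mpoly_eval (f j) (\<lambda>i. x $ i))" by simp
    qed
    then have "p \<in> vanishing_ideal \<gamma>" using Q by (simp add: vanishing_ideal_def)
    moreover have "\<alpha> \<notin> lead_monoms \<gamma>" if "\<alpha> \<in> Poly_Mapping.keys p" for \<alpha>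
      using that keys_reindex[of \<phi> "\<lambda>c. c" Q] \<phi> by (auto simp: p_def)
    ultimately have "p = 0" by (metis obtain_lead)
    then have "Poly_Mapping.lookup Q \<alpha> = 0" for \<alpha>
      using lookup_reindex[OF inj, of \<alpha> "\<lambda>c. c"] by (cases "\<alpha> \<in> Poly_Mapping.keys Q") (auto simp: p_def in_keys_iff)
    then show "Q = 0" by (intro poly_mapping_eqI) simp
  qed
  then have "enat 2 \<le> irreducible_dim \<gamma>"
    unfolding irreducible_dim_def by (intro Sup_upper) blast
  then show False using dim by (simp add: one_enat_def)
qed

text \<open>There are finitely many pairs, and multiples of leading monomials are leading, so the
  largest of the exponents works for all.\<close>

lemma pair_monoms_lead:
  fixes \<gamma> :: "(real ^ 'n::finite) set"
  assumes "irreducible_dim \<gamma> = 1"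
  obtains K where "\<And>a b. a \<noteq> b \<Longrightarrow> Poly_Mapping.single a K + Poly_Mapping.single b K \<in> lead_monoms \<gamma>"
proof -
  have "\<forall>a b. \<exists>K. a \<noteq> b \<longrightarrow> Poly_Mapping.single a K + Poly_Mapping.single b K \<in> lead_monoms \<gamma>"
    using pair_monom_lead[OF assms] by blast
  then obtain k where k: "\<And>a b. a \<noteq> b \<Longrightarrow>
      Poly_Mapping.single a (k a b) + Poly_Mapping.single b (k a b) \<in> lead_monoms \<gamma>"
    by metis
  define K where "K = Max (range (\<lambda>(a, b). k a b))"
  have K: "k a b \<le> K" for a b
    unfolding K_def by (rule Max_ge) (auto intro: rev_image_eqI[of "(a, b)"])
  show ?thesis
  proof (rule that[of K])
    fix a b :: 'n assume "a \<noteq> b"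
    then show "Poly_Mapping.single a K + Poly_Mapping.single b K \<in> lead_monoms \<gamma>"
      by (intro lead_monoms_mono[OF k]) (auto simp: lookup_add lookup_single when_def K)
  qed
qed

definition std_slice :: "(real ^ 'n::finite) set \<Rightarrow> nat \<Rightarrow> ('n \<Rightarrow>\<^sub>0 nat) set" where
  "std_slice \<gamma> m = {\<alpha>. monom_degree \<alpha> = m \<and> \<alpha> \<notin> lead_monoms \<gamma>}"

lemma finite_std: "finite (std_monoms \<gamma> m)" "finite (std_slice \<gamma> m)"
  by (rule finite_subset[OF _ finite_monom_degree_le[of m]]; force simp: std_monoms_def std_slice_def)+

text \<open>A standard monomial of large degree is large in exactly one variable; dividing by that variable
  is an injection between consecutive degrees.\<close>

lemma std_slice_eventually_decreasing:
  fixes \<gamma> :: "(real ^ 'n::finite) set"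
  assumes "irreducible_dim \<gamma> = 1"
  shows "\<exists>M. \<forall>m\<ge>M. card (std_slice \<gamma> (Suc m)) \<le> card (std_slice \<gamma> m)"
proof -
  obtain K where K: "\<And>a b. a \<noteq> b \<Longrightarrow>
      Poly_Mapping.single a K + Poly_Mapping.single b K \<in> lead_monoms \<gamma>"
    using pair_monoms_lead[OF assms] by blast
  have uniq: "a = b" if "\<alpha> \<notin> lead_monoms \<gamma>" "K \<le> Poly_Mapping.lookup \<alpha> a" "K \<le> Poly_Mapping.lookup \<alpha> b"
    for \<alpha> and a b :: 'n
  proof (rule ccontr)
    assume "a \<noteq> b"
    then have "\<alpha> \<in> lead_monoms \<gamma>"
      using that by (intro lead_monoms_mono[OF K[of a b]]) (auto simp: lookup_add lookup_single when_def)
    with that show False by blast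
  qed
  show ?thesis
  proof (intro exI allI impI)
    \<comment> \<open>If all exponents were at most \<open>K\<close>, the degree would be at most
      \<open>CARD('n) * K\<close>, which is less than \<open>Suc m\<close>.\<close>
    fix m assume m: "CARD('n) * K \<le> m"
    have "\<exists>a. K < Poly_Mapping.lookup \<alpha> a" if "\<alpha> \<in> std_slice \<gamma> (Suc m)" for \<alpha>
    proof (rule ccontr)
      assume "\<nexists>a. K < Poly_Mapping.lookup \<alpha> a"
      then have "monom_degree \<alpha> \<le> (\<Sum>v\<in>(UNIV :: 'n set). K)"
        unfolding monom_degree_UNIV by (intro sum_mono) (simp add: not_less)
      then show False using that m by (simp add: std_slice_def)
    qed
    then obtain a where a: "\<And>\<alpha>. \<alpha> \<in> std_slice \<gamma> (Suc m) \<Longrightarrow> K < Poly_Mapping.lookup \<alpha> (a \<alpha>)"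
      by metis
    define \<phi> where "\<phi> = (\<lambda>\<alpha>. \<alpha> - Poly_Mapping.single (a \<alpha>) (1::nat))"
    have \<phi>: "\<phi> \<alpha> + Poly_Mapping.single (a \<alpha>) 1 = \<alpha>" if "\<alpha> \<in> std_slice \<gamma> (Suc m)" for \<alpha>
      using a[OF that]
      by (intro poly_mapping_eqI) (auto simp: \<phi>_def lookup_add lookup_minus lookup_single when_def)
    have mem: "\<phi> \<alpha> \<in> std_slice \<gamma> m" if "\<alpha> \<in> std_slice \<gamma> (Suc m)" for \<alpha>
    proof -
      have "monom_degree \<alpha> = Suc (monom_degree (\<phi> \<alpha>))"
        using monom_degree_add[of "\<phi> \<alpha>" "Poly_Mapping.single (a \<alpha>) 1"] \<phi>[OF that] by simp
      moreover have "\<phi> \<alpha> \<notin> lead_monoms \<gamma>"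
        using lead_monoms_add[of "\<phi> \<alpha>" \<gamma> "Poly_Mapping.single (a \<alpha>) 1"] \<phi>[OF that] that
        by (auto simp: std_slice_def)
      ultimately show ?thesis using that by (simp add: std_slice_def)
    qed
    have "inj_on \<phi> (std_slice \<gamma> (Suc m))"
    proof (rule inj_onI)
      fix \<alpha> \<beta> assume *: "\<alpha> \<in> std_slice \<gamma> (Suc m)" "\<beta> \<in> std_slice \<gamma> (Suc m)" "\<phi> \<alpha> = \<phi> \<beta>"
      \<comment> \<open>The exponent exceeded \<open>K\<close>, so after the division it is still at
        least \<open>K\<close>. By \<open>uniq\<close> the quotient therefore reveals which variable
        was removed.\<close>
      have "K \<le> Poly_Mapping.lookup (\<phi> \<alpha>) (a \<alpha>)" "K \<le> Poly_Mapping.lookup (\<phi> \<beta>) (a \<beta>)"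
        using a[OF *(1)] a[OF *(2)] by (simp_all add: \<phi>_def lookup_minus)
      then have "a \<alpha> = a \<beta>"
        using uniq[of "\<phi> \<alpha>"] mem[OF *(1)] *(3) by (auto simp: std_slice_def)
      then show "\<alpha> = \<beta>" using \<phi>[OF *(1)] \<phi>[OF *(2)] *(3) by metis
    qed
    then show "card (std_slice \<gamma> (Suc m)) \<le> card (std_slice \<gamma> m)"
      by (rule card_inj_on_le) (use mem finite_std in auto)
  qed
qed

text \<open>Once the smallest value attained from \<open>M\<close> on has been reached, the sequence
  can neither rise above it nor fall below it.\<close>

lemma eventually_decreasing_nat_constant:
  fixes h :: "nat \<Rightarrow> nat"
  assumes "\<And>m. m \<ge> M \<Longrightarrow> h (Suc m) \<le> h m"
  shows "\<exists>e m0. \<forall>m\<ge>m0. h m = e"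
proof -
  define e where "e = (LEAST e. \<exists>m\<ge>M. h m = e)"
  have "\<exists>m\<ge>M. h m = e" unfolding e_def by (rule LeastI_ex) blast
  then obtain m0 where m0: "m0 \<ge> M" "h m0 = e" by blast
  have "h m = e" if "m \<ge> m0" for m
  proof (rule antisym)
    have "h m \<le> h m0" using that
    proof (induction rule: dec_induct)
      case (step k)
      then show ?case using assms[of k] m0(1) by simp
    qed simp
    then show "h m \<le> e" using m0(2) by simp
    show "e \<le> h m" unfolding e_def by (rule Least_le, rule exI[of _ m]) (use that m0(1) in simp)
  qed
  then show ?thesis by blast
qed

text \<open>The increments are the numbers of standard monomials of exact degree, which are
  eventually constant; this constant is the slope \<open>e\<close>.\<close>

lemma card_std_monoms_linear:
  fixes \<gamma> :: "(real ^ 'n::finite) set"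
  assumes "irreducible_dim \<gamma> = 1"
  shows "\<exists>e m0. \<forall>m\<ge>m0. \<forall>k. card (std_monoms \<gamma> (m + k)) = card (std_monoms \<gamma> m) + e * k"
proof -
  obtain M where "\<forall>m\<ge>M. card (std_slice \<gamma> (Suc m)) \<le> card (std_slice \<gamma> m)"
    using std_slice_eventually_decreasing[OF assms] by (elim exE)
  then have "\<exists>e m0. \<forall>m\<ge>m0. card (std_slice \<gamma> m) = e"
    by (intro eventually_decreasing_nat_constant[of M]) simp
  then obtain e m0 where e: "\<And>m. m \<ge> m0 \<Longrightarrow> card (std_slice \<gamma> m) = e"
    by blast
  have step: "card (std_monoms \<gamma> (Suc m)) = card (std_monoms \<gamma> m) + card (std_slice \<gamma> (Suc m))" for m
  proof -
    have "std_monoms \<gamma> (Suc m) = std_monoms \<gamma> m \<union> std_slice \<gamma> (Suc m)"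
      by (auto simp: std_monoms_def std_slice_def)
    moreover have "std_monoms \<gamma> m \<inter> std_slice \<gamma> (Suc m) = {}"
      by (auto simp: std_monoms_def std_slice_def)
    ultimately show ?thesis by (simp add: card_Un_disjoint finite_std)
  qed
  have "card (std_monoms \<gamma> (m + k)) = card (std_monoms \<gamma> m) + e * k" if "m \<ge> m0" for m k
  proof (induction k)
    case (Suc k)
    then show ?case using step[of "m + k"] e[of "Suc (m + k)"] that by simp
  qed simp
  then show ?thesis by blast
qed

text \<open>Otherwise the difference would be a nonzero polynomial with infinitely many roots. This
  gives the uniqueness behind the definite description in \<open>hilbert_polynomial\<close>.\<close>

lemma poly_eq_if_eventually_eq:
  fixes P Q :: "real poly"
  assumes "\<forall>\<^sub>F m in sequentially. poly P (real m) = poly Q (real m)"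
  shows "P = Q"
proof (rule ccontr)
  assume "P \<noteq> Q"
  then have "finite {x. poly (P - Q) x = 0}" by (intro poly_roots_finite) simp
  moreover obtain N where "\<And>m. m \<ge> N \<Longrightarrow> poly P (real m) = poly Q (real m)"
    using assms by (auto simp: eventually_sequentially)
  then have "real ` {N..} \<subseteq> {x. poly (P - Q) x = 0}" by auto
  ultimately have "finite (real ` {N..})" by (rule rev_finite_subset)
  then have "finite {N..}" by (rule finite_imageD) (simp add: inj_on_def)
  then show False by (simp add: infinite_Ici)
qed

lemma growth_le_degree:
  fixes \<gamma> :: "(real ^ 'n::finite) set"
  assumes lin: "\<And>m k. m \<ge> m0 \<Longrightarrow> card (std_monoms \<gamma> (m + k)) = card (std_monoms \<gamma> m) + e * k"
    and deg: "alg_degree \<gamma> \<le> real d"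
  shows "e \<le> d"
\<comment> \<open>For \<open>e = 0\<close> the Hilbert polynomial is constant and its leading
  coefficient need not be \<open>e\<close>, but the claim is trivial. Otherwise it is linear with
  leading coefficient \<open>e\<close>, and the factorial factor is 1.\<close>
proof (cases "e = 0")
  case False
  let ?X = "zariski_closure (proj_embed ` \<gamma>)"
  \<comment> \<open>The line of slope \<open>e\<close> that takes at \<open>m0\<close> the value of
    the Hilbert function.\<close>
  define P where "P = [:real (card (std_monoms \<gamma> m0)) - real e * real m0, real e:]"
  have H: "real (hilbert_function ?X m) = poly P (real m)" if "m \<ge> m0" for m
  proof -
    have "real (card (std_monoms \<gamma> m)) = real (card (std_monoms \<gamma> m0)) + real e * real (m - m0)"
      using lin[of m0 "m - m0"] that by simp
    then show ?thesis
      using that by (simp add: hilbert_function_eq_card_std_monoms P_def of_nat_diff algebra_simps)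
  qed
  then have ev: "\<forall>\<^sub>F m in sequentially. real (hilbert_function ?X m) = poly P (real m)"
    by (auto simp: eventually_sequentially)
  have "hilbert_polynomial ?X = P"
    unfolding hilbert_polynomial_def
  proof (rule the_equality)
    fix Q assume "\<forall>\<^sub>F m in sequentially. real (hilbert_function ?X m) = poly Q (real m)"
    with ev have "\<forall>\<^sub>F m in sequentially. poly Q (real m) = poly P (real m)"
      by eventually_elim simp
    then show "Q = P" by (rule poly_eq_if_eventually_eq)
  qed (rule ev)
  then have "alg_degree \<gamma> = real e"
    using False by (simp add: alg_degree_def proj_degree_def P_def)
  then show ?thesis using deg by simp
qed simp

subsection \<open>Zeros of a polynomial on a curve\<close>

text \<open>Elimination, one equation at a time: if equation \<open>x\<close> involves an unknown
  \<open>b\<close>, solve it for \<open>b\<close> and substitute into the others, leaving one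
  equation and one unknown fewer.\<close>

lemma underdetermined_system:
  fixes M :: "'a \<Rightarrow> 'b \<Rightarrow> real"
  assumes "finite X" "finite A" "card X < card A"
  shows "\<exists>c. (\<exists>a\<in>A. c a \<noteq> 0) \<and> (\<forall>x\<in>X. (\<Sum>a\<in>A. c a * M a x) = 0)"
  using assms
proof (induction X arbitrary: A M rule: finite_induct)
  case empty
  then have "A \<noteq> {}" by auto
  then show ?case by (intro exI[of _ "\<lambda>_. 1"]) auto
next
  case (insert x X)
  show ?case
  proof (cases "\<forall>a\<in>A. M a x = 0")
    case True
    then show ?thesis using insert.IH[of A M] insert by simp
  next
    case False
    then obtain b where b: "b \<in> A" "M b x \<noteq> 0" by blast
    let ?B = "A - {b}"
    have "card X < card ?B" using insert b by simp
    then obtain c where c: "\<exists>a\<in>?B. c a \<noteq> 0"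
        "\<And>y. y \<in> X \<Longrightarrow> (\<Sum>a\<in>?B. c a * (M a y - M a x / M b x * M b y)) = 0"
      using insert.IH[of ?B "\<lambda>a y. M a y - M a x / M b x * M b y"] insert.prems by auto
    \<comment> \<open>The value at \<open>b\<close> is the one forced by equation
      \<open>x\<close>.\<close>
    define c' where "c' = c(b := - (\<Sum>a\<in>?B. c a * M a x) / M b x)"
    have sum: "(\<Sum>a\<in>A. c' a * M a y) =
        (\<Sum>a\<in>?B. c a * M a y) - (\<Sum>a\<in>?B. c a * M a x) / M b x * M b y" for y
    proof -
      have "(\<Sum>a\<in>A. c' a * M a y) = c' b * M b y + (\<Sum>a\<in>?B. c' a * M a y)"
        using insert.prems b(1) by (simp add: sum.remove)
      also have "(\<Sum>a\<in>?B. c' a * M a y) = (\<Sum>a\<in>?B. c a * M a y)"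
        by (rule sum.cong) (auto simp: c'_def)
      finally show ?thesis by (simp add: c'_def)
    qed
    have "(\<Sum>a\<in>A. c' a * M a y) = 0" if "y \<in> insert x X" for y
    proof (cases "y = x")
      case True
      then show ?thesis using sum[of x] b(2) by simp
    next
      case False
      then have "0 = (\<Sum>a\<in>?B. c a * (M a y - M a x / M b x * M b y))" using c(2) that by simp
      also have "\<dots> = (\<Sum>a\<in>?B. c a * M a y) - (\<Sum>a\<in>?B. c a * M a x * (M b y / M b x))"
        by (simp add: algebra_simps sum_subtractf)
      finally show ?thesis using sum[of y] by (simp add: sum_distrib_right sum_divide_distrib)
    qed
    moreover have "\<exists>a\<in>A. c' a \<noteq> 0" using c(1) by (auto simp: c'_def)
    ultimately show ?thesis by blast
  qed
qed

lemma subspace_vanishing_ideal_le: "mpoly.subspace (vanishing_ideal \<gamma> \<inter> mpolys_le m)"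
proof -
  have "mpoly.subspace (mpolys_le m :: ('n, real) mpoly set)"
    using subspace_keys_subset[of "{\<alpha> :: 'n \<Rightarrow>\<^sub>0 nat. monom_degree \<alpha> \<le> m}"]
    by (simp add: mpolys_le_def subset_iff Ball_def)
  then show ?thesis
    by (auto simp: mpoly.subspace_def vanishing_ideal_def mpoly_eval_add mpoly_eval_scale)
qed

text \<open>On \<open>\<gamma>\<close> each \<open>g j\<close> agrees with its normal form, a
  combination of standard monomials. With more functions than standard monomials, the coefficient
  vectors satisfy a nontrivial relation.\<close>

lemma card_independent_le_std_monoms:
  fixes \<gamma> :: "(real ^ 'n::finite) set" and g :: "'j \<Rightarrow> ('n, real) mpoly"
  assumes J: "finite J" and g: "\<And>j. j \<in> J \<Longrightarrow> g j \<in> mpolys_le m"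
    and ind: "\<And>c. (\<And>x. x \<in> \<gamma> \<Longrightarrow> (\<Sum>j\<in>J. c j * mpoly_eval (g j) (\<lambda>i. x $ i)) = 0) \<Longrightarrow> \<forall>j\<in>J. c j = 0"
  shows "card J \<le> card (std_monoms \<gamma> m)"
proof (rule ccontr)
  assume "\<not> card J \<le> card (std_monoms \<gamma> m)"
  then have lt: "card (std_monoms \<gamma> m) < card J" by simp
  let ?V = "vanishing_ideal \<gamma> \<inter> mpolys_le m" and ?S = "{\<alpha> :: 'n \<Rightarrow>\<^sub>0 nat. monom_degree \<alpha> \<le> m}"
  have std: "?S - leads grlex_key ?V = std_monoms \<gamma> m"
    unfolding leads_vanishing_ideal_le std_monoms_def by auto
  have "\<exists>r. g j - r \<in> ?V \<and> Poly_Mapping.keys r \<subseteq> ?S - leads grlex_key ?V" if "j \<in> J" for j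
    by (rule normal_form_exists[OF subspace_vanishing_ideal_le _ finite_monom_degree_le])
       (use g[OF that] in \<open>auto simp: mpolys_le_def intro: inj_on_subset[OF inj_grlex_key]\<close>)
  then obtain r where r: "\<And>j. j \<in> J \<Longrightarrow> g j - r j \<in> vanishing_ideal \<gamma>"
      "\<And>j. j \<in> J \<Longrightarrow> Poly_Mapping.keys (r j) \<subseteq> std_monoms \<gamma> m"
    unfolding std by (metis IntD1)
  obtain c where c: "\<exists>j\<in>J. c j \<noteq> 0"
      "\<And>\<beta>. \<beta> \<in> std_monoms \<gamma> m \<Longrightarrow> (\<Sum>j\<in>J. c j * Poly_Mapping.lookup (r j) \<beta>) = 0"
    using underdetermined_system[OF finite_std(1) J lt, of "\<lambda>j. Poly_Mapping.lookup (r j)"] by blast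
  have "(\<Sum>j\<in>J. c j * mpoly_eval (g j) (\<lambda>i. x $ i)) = 0" if x: "x \<in> \<gamma>" for x
  proof -
    have "(\<Sum>j\<in>J. c j * mpoly_eval (g j) (\<lambda>i. x $ i)) =
        (\<Sum>j\<in>J. \<Sum>\<beta>\<in>std_monoms \<gamma> m. c j * Poly_Mapping.lookup (r j) \<beta> * monom_eval \<beta> (\<lambda>i. x $ i))"
    proof (rule sum.cong[OF refl])
      fix j assume j: "j \<in> J"
      have "mpoly_eval (g j) (\<lambda>i. x $ i) = mpoly_eval (r j) (\<lambda>i. x $ i)"
        using r(1)[OF j] x by (simp add: vanishing_ideal_def mpoly_eval_diff)
      then show "c j * mpoly_eval (g j) (\<lambda>i. x $ i) =
          (\<Sum>\<beta>\<in>std_monoms \<gamma> m. c j * Poly_Mapping.lookup (r j) \<beta> * monom_eval \<beta> (\<lambda>i. x $ i))"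
        using mpoly_eval_superset[OF finite_std(1) r(2)[OF j]] by (simp add: sum_distrib_left mult.assoc)
    qed
    also have "\<dots> = (\<Sum>\<beta>\<in>std_monoms \<gamma> m. (\<Sum>j\<in>J. c j * Poly_Mapping.lookup (r j) \<beta>) * monom_eval \<beta> (\<lambda>i. x $ i))"
      by (subst sum.swap) (simp add: sum_distrib_right)
    finally show ?thesis using c(2) by simp
  qed
  then have "\<forall>j\<in>J. c j = 0" by (rule ind)
  with c(1) show False by blast
qed

text \<open>The set \<open>\<gamma>\<close> is the union of its intersections with the zero sets of
  \<open>P\<close> and \<open>Q\<close>; irreducibility makes one of them all of
  \<open>\<gamma>\<close>.\<close>

lemma vanishing_ideal_prime:
  assumes irr: "irreducible_real_algebraic \<gamma>"
    and PQ: "\<And>x. x \<in> \<gamma> \<Longrightarrow> mpoly_eval P (\<lambda>i. x $ i) * mpoly_eval Q (\<lambda>i. x $ i) = 0"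
  shows "P \<in> vanishing_ideal \<gamma> \<or> Q \<in> vanishing_ideal \<gamma>"
proof -
  obtain F where F: "\<gamma> = real_zeros F"
    using irr by (auto simp: irreducible_real_algebraic_def real_algebraic_def)
  have "real_algebraic (real_zeros (insert P F))" "real_algebraic (real_zeros (insert Q F))"
    by (auto simp: real_algebraic_def)
  moreover have "\<gamma> = real_zeros (insert P F) \<union> real_zeros (insert Q F)"
    using PQ by (auto simp: F real_zeros_def)
  ultimately have "\<gamma> = real_zeros (insert P F) \<or> \<gamma> = real_zeros (insert Q F)"
    using irr unfolding irreducible_real_algebraic_def by blast
  then show ?thesis by (auto simp: real_zeros_def vanishing_ideal_def)
qed

lemma separating_poly_exists:
  fixes z :: "real ^ 'n::finite"
  assumes "finite Z" "z \<notin> Z"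
  shows "\<exists>p :: ('n, real) mpoly. mpoly_eval p (\<lambda>i. z $ i) \<noteq> 0 \<and> (\<forall>y\<in>Z. mpoly_eval p (\<lambda>i. y $ i) = 0)"
  using assms
proof (induction Z rule: finite_induct)
  case empty
  show ?case by (rule exI[of _ 1]) simp
next
  case (insert w Z)
  then obtain p :: "('n, real) mpoly" where p: "mpoly_eval p (\<lambda>i. z $ i) \<noteq> 0" "\<And>y. y \<in> Z \<Longrightarrow> mpoly_eval p (\<lambda>i. y $ i) = 0"
    by auto
  \<comment> \<open>The new factor is the \<open>i\<close>-th coordinate minus its value at
    \<open>w\<close>, for a coordinate that tells \<open>z\<close> from \<open>w\<close>.\<close>
  obtain i where i: "z $ i \<noteq> w $ i" using insert.prems by (auto simp: vec_eq_iff)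
  define q :: "('n, real) mpoly" where
    "q = Poly_Mapping.single (Poly_Mapping.single i 1) 1 - Poly_Mapping.single 0 (w $ i)"
  have "mpoly_eval (p * q) (\<lambda>i. y $ i) = mpoly_eval p (\<lambda>i. y $ i) * (y $ i - w $ i)" for y
    by (simp add: q_def mpoly_eval_mult mpoly_eval_diff)
  then show ?case using p i by (intro exI[of _ "p * q"]) auto
qed

text \<open>The products of \<open>Q\<close> with the standard monomials of degree at most
  \<open>m\<close>, together with one separating polynomial per point of \<open>Z\<close>, are
  independent on \<open>\<gamma>\<close> and have degree at most \<open>m + k\<close>. Comparing
  with the growth of the Hilbert function leaves \<open>e * k\<close> for \<open>Z\<close>.\<close>

lemma zeros_on_curve_le:
  fixes \<gamma> :: "(real ^ 'n::finite) set"
  assumes irr: "irreducible_real_algebraic \<gamma>"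
    and lin: "\<And>m k. m \<ge> m0 \<Longrightarrow> card (std_monoms \<gamma> (m + k)) = card (std_monoms \<gamma> m) + e * k"
    and Q: "Q \<in> mpolys_le k" "Q \<notin> vanishing_ideal \<gamma>"
    and Z: "finite Z" "Z \<subseteq> \<gamma>" "\<And>z. z \<in> Z \<Longrightarrow> mpoly_eval Q (\<lambda>i. z $ i) = 0"
  shows "card Z \<le> e * k"
proof -
  have "\<exists>p :: ('n, real) mpoly. mpoly_eval p (\<lambda>i. z $ i) \<noteq> 0 \<and> (\<forall>y\<in>Z - {z}. mpoly_eval p (\<lambda>i. y $ i) = 0)" for z
    using Z(1) by (intro separating_poly_exists) auto
  then obtain s :: "real ^ 'n \<Rightarrow> ('n, real) mpoly" where s: "\<And>z. mpoly_eval (s z) (\<lambda>i. z $ i) \<noteq> 0"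
      "\<And>z y. y \<in> Z \<Longrightarrow> y \<noteq> z \<Longrightarrow> mpoly_eval (s z) (\<lambda>i. y $ i) = 0"
    by (metis DiffI singletonD)
  have "\<forall>z. \<exists>D. s z \<in> mpolys_le D" using mpolys_le_exists by blast
  then obtain D where D: "\<And>z. s z \<in> mpolys_le (D z)" by metis
  \<comment> \<open>Large enough both for the linear growth to have set in and for the degrees of
    all separating polynomials.\<close>
  define m where "m = m0 + (\<Sum>z\<in>Z. D z)"
  have sm: "s z \<in> mpolys_le m" if "z \<in> Z" for z
  proof -
    have "D z \<le> (\<Sum>z\<in>Z. D z)" using that Z(1) by (intro member_le_sum) auto
    then show ?thesis using D[of z] mpolys_le_mono[of "D z" m] by (auto simp: m_def)
  qed
  let ?J = "std_monoms \<gamma> m <+> Z"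
  define g where "g = case_sum (\<lambda>\<beta>. Q * Poly_Mapping.single \<beta> 1) s"
  have "card ?J \<le> card (std_monoms \<gamma> (m + k))"
  proof (rule card_independent_le_std_monoms)
    show "finite ?J" using finite_std(1) Z(1) by (rule finite_Plus)
    show "g j \<in> mpolys_le (m + k)" if "j \<in> ?J" for j
    proof (cases j)
      case (Inl \<beta>)
      then have "Poly_Mapping.single \<beta> 1 \<in> mpolys_le m"
        using that by (auto simp: mpolys_le_def std_monoms_def)
      then show ?thesis using mpolys_le_mult[OF Q(1)] Inl by (simp add: g_def add.commute[of m k])
    next
      case (Inr z)
      then show ?thesis using that sm[of z] mpolys_le_mono[of m "m + k"] by (auto simp: g_def)
    qed
    fix c assume c: "\<And>x. x \<in> \<gamma> \<Longrightarrow> (\<Sum>j\<in>?J. c j * mpoly_eval (g j) (\<lambda>i. x $ i)) = 0"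
    define P where "P = (\<Sum>\<beta>\<in>std_monoms \<gamma> m. Poly_Mapping.single \<beta> (c (Inl \<beta>)))"
    have split: "mpoly_eval Q (\<lambda>i. x $ i) * mpoly_eval P (\<lambda>i. x $ i) +
        (\<Sum>z\<in>Z. c (Inr z) * mpoly_eval (s z) (\<lambda>i. x $ i)) = 0" if "x \<in> \<gamma>" for x
      using c[OF that] finite_std(1)[of \<gamma> m] Z(1)
      by (simp add: sum.Plus g_def P_def mpoly_eval_mult mpoly_eval_sum sum_distrib_left mult_ac)
    \<comment> \<open>At \<open>z\<close> all multiples of \<open>Q\<close> vanish, and so do the
      separating polynomials of the other points.\<close>
    have cZ: "c (Inr z) = 0" if z: "z \<in> Z" for z
    proof -
      have "0 = (\<Sum>y\<in>Z. c (Inr y) * mpoly_eval (s y) (\<lambda>i. z $ i))"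
        using split[of z] Z(2) Z(3)[OF z] z by auto
      also have "\<dots> = (\<Sum>y\<in>Z. if y = z then c (Inr z) * mpoly_eval (s z) (\<lambda>i. z $ i) else 0)"
        by (rule sum.cong) (use s(2) z in auto)
      finally show ?thesis using Z(1) z s(1)[of z] by simp
    qed
    \<comment> \<open>What remains of the relation is \<open>Q * P = 0\<close> on
      \<open>\<gamma>\<close>, and primality cancels \<open>Q\<close>.\<close>
    have "Q \<in> vanishing_ideal \<gamma> \<or> P \<in> vanishing_ideal \<gamma>"
      by (rule vanishing_ideal_prime[OF irr]) (use split cZ in simp)
    then have PI: "P \<in> vanishing_ideal \<gamma>" using Q(2) by blast
    have lookup: "Poly_Mapping.lookup P \<beta> = (if \<beta> \<in> std_monoms \<gamma> m then c (Inl \<beta>) else 0)" for \<beta>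
      using finite_std(1)[of \<gamma> m] by (simp add: P_def lookup_sum lookup_single when_def)
    \<comment> \<open>All monomials of \<open>P\<close> are standard, whereas a nonzero element of
      the ideal contains its leading monomial.\<close>
    have "P = 0"
    proof (rule ccontr)
      assume "P \<noteq> 0"
      with PI obtain \<alpha> where "\<alpha> \<in> Poly_Mapping.keys P" "\<alpha> \<in> lead_monoms \<gamma>" by (rule obtain_lead)
      then show False by (auto simp: in_keys_iff lookup std_monoms_def split: if_splits)
    qed
    then have "c (Inl \<beta>) = 0" if "\<beta> \<in> std_monoms \<gamma> m" for \<beta> using lookup[of \<beta>] that by simp
    with cZ show "\<forall>j\<in>?J. c j = 0" by auto
  qed
  then show ?thesis
    using lin[of m k] finite_std(1)[of \<gamma> m] Z(1) by (simp add: card_Plus m_def)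
qed

text \<open>The Bezout bound in the form used for joints: the slope of the Hilbert function is at
  most \<open>d\<close>, so more than \<open>d * k\<close> zeros are too many for a polynomial that
  does not vanish identically on the curve.\<close>

lemma vanishes_on_curve_if_many_zeros:
  fixes \<gamma> :: "(real ^ 'n::finite) set"
  assumes "irreducible_algebraic_curve \<gamma>" "alg_degree \<gamma> \<le> real d"
    and "Q \<in> mpolys_le k" "finite Z" "Z \<subseteq> \<gamma>" "\<And>z. z \<in> Z \<Longrightarrow> mpoly_eval Q (\<lambda>i. z $ i) = 0"
    and "d * k < card Z"
  shows "Q \<in> vanishing_ideal \<gamma>"
proof (rule ccontr)
  assume n: "Q \<notin> vanishing_ideal \<gamma>"
  have irr: "irreducible_real_algebraic \<gamma>" and dim: "irreducible_dim \<gamma> = 1"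
    using assms(1) by (auto simp: irreducible_algebraic_curve_def)
  obtain e m0 where "\<forall>m\<ge>m0. \<forall>k. card (std_monoms \<gamma> (m + k)) = card (std_monoms \<gamma> m) + e * k"
    using card_std_monoms_linear[OF dim] by (elim exE)
  then have lin: "\<And>m k. m \<ge> m0 \<Longrightarrow> card (std_monoms \<gamma> (m + k)) = card (std_monoms \<gamma> m) + e * k"
    by blast
  have "card Z \<le> e * k" by (rule zeros_on_curve_le[OF irr lin assms(3) n assms(4,5,6)])
  also have "\<dots> \<le> d * k" using growth_le_degree[OF lin assms(2)] by simp
  finally show False using assms(7) by simp
qed

subsection \<open>Partial derivatives and joints\<close>

text \<open>The truncated subtraction is harmless: the coefficient is \<open>0\<close> if the exponent of \<open>i\<close> is.\<close>

definition mpoly_partial :: "'n \<Rightarrow> ('n, real) mpoly \<Rightarrow> ('n, real) mpoly" where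
  "mpoly_partial i p = (\<Sum>\<alpha>\<in>Poly_Mapping.keys p.
     Poly_Mapping.single (\<alpha> - Poly_Mapping.single i 1)
       (Poly_Mapping.lookup p \<alpha> * real (Poly_Mapping.lookup \<alpha> i)))"

text \<open>A single monomial of \<open>p\<close> contributes to each \<open>\<beta>\<close>, and
  the factor is its exponent of \<open>i\<close>. In this form the drop in degree and the survival
  of nonconstant terms can be read off.\<close>

lemma lookup_mpoly_partial:
  "Poly_Mapping.lookup (mpoly_partial i p) \<beta> =
    Poly_Mapping.lookup p (\<beta> + Poly_Mapping.single i 1) * (real (Poly_Mapping.lookup \<beta> i) + 1)"
proof -
  let ?\<alpha> = "\<beta> + Poly_Mapping.single i 1"
  have "Poly_Mapping.lookup (mpoly_partial i p) \<beta> = (\<Sum>\<alpha>\<in>Poly_Mapping.keys p.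
      if \<alpha> = ?\<alpha> then Poly_Mapping.lookup p ?\<alpha> * real (Poly_Mapping.lookup ?\<alpha> i) else 0)"
    unfolding mpoly_partial_def lookup_sum
  proof (rule sum.cong[OF refl])
    fix \<alpha>
    have "\<alpha> = ?\<alpha>" if "\<alpha> - Poly_Mapping.single i 1 = \<beta>" "Poly_Mapping.lookup \<alpha> i \<noteq> 0"
    proof (rule poly_mapping_eqI)
      fix v
      show "Poly_Mapping.lookup \<alpha> v = Poly_Mapping.lookup ?\<alpha> v"
        unfolding that(1)[symmetric]
        using that(2) by (auto simp: lookup_add lookup_minus lookup_single when_def)
    qed
    note div = this
    show "Poly_Mapping.lookup (Poly_Mapping.single (\<alpha> - Poly_Mapping.single i 1)
        (Poly_Mapping.lookup p \<alpha> * real (Poly_Mapping.lookup \<alpha> i))) \<beta> =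
        (if \<alpha> = ?\<alpha> then Poly_Mapping.lookup p ?\<alpha> * real (Poly_Mapping.lookup ?\<alpha> i) else 0)"
    proof (cases "\<alpha> - Poly_Mapping.single i 1 = \<beta> \<and> Poly_Mapping.lookup \<alpha> i \<noteq> 0")
      case True
      then have "?\<alpha> = \<alpha>" using div by metis
      with True show ?thesis by (simp only: if_True lookup_single_eq simp_thms)
    next
      case False
      then have "\<alpha> \<noteq> ?\<alpha>" by (auto simp: lookup_add)
      with False show ?thesis by (auto simp: lookup_single when_def)
    qed
  qed
  then show ?thesis by (simp add: lookup_add in_keys_iff)
qed

lemma monom_eval_has_derivative:
  fixes x :: "real ^ 'n::finite"
  shows "((\<lambda>x. monom_eval \<alpha> (\<lambda>i. x $ i)) has_derivative
    (\<lambda>h. \<Sum>i\<in>UNIV. h $ i * (real (Poly_Mapping.lookup \<alpha> i) *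
      monom_eval (\<alpha> - Poly_Mapping.single i 1) (\<lambda>i. x $ i)))) (at x)"
proof -
  have "((\<lambda>x. \<Prod>i\<in>UNIV. x $ i ^ Poly_Mapping.lookup \<alpha> i) has_derivative
      (\<lambda>h. \<Sum>i\<in>UNIV. (real (Poly_Mapping.lookup \<alpha> i) * h $ i * x $ i ^ (Poly_Mapping.lookup \<alpha> i - 1)) *
        (\<Prod>j\<in>UNIV - {i}. x $ j ^ Poly_Mapping.lookup \<alpha> j))) (at x)"
    by (rule has_derivative_prod) (auto intro!: derivative_eq_intros bounded_linear_imp_has_derivative bounded_linear_vec_nth simp: mult_ac)
  moreover have "monom_eval (\<alpha> - Poly_Mapping.single i 1) (\<lambda>i. x $ i) =
      x $ i ^ (Poly_Mapping.lookup \<alpha> i - 1) * (\<Prod>j\<in>UNIV - {i}. x $ j ^ Poly_Mapping.lookup \<alpha> j)" for i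
  proof -
    have "monom_eval (\<alpha> - Poly_Mapping.single i 1) (\<lambda>i. x $ i) =
        x $ i ^ (Poly_Mapping.lookup \<alpha> i - 1) *
        (\<Prod>j\<in>UNIV - {i}. x $ j ^ Poly_Mapping.lookup (\<alpha> - Poly_Mapping.single i 1) j)"
      unfolding monom_eval_UNIV by (subst prod.remove[of _ i]) (simp_all add: lookup_minus)
    also have "(\<Prod>j\<in>UNIV - {i}. x $ j ^ Poly_Mapping.lookup (\<alpha> - Poly_Mapping.single i 1) j) =
        (\<Prod>j\<in>UNIV - {i}. x $ j ^ Poly_Mapping.lookup \<alpha> j)"
      by (rule prod.cong) (auto simp: lookup_minus lookup_single when_def)
    finally show ?thesis .
  qed
  ultimately show ?thesis by (simp add: monom_eval_UNIV[symmetric] mult_ac)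
qed

lemma mpoly_eval_has_derivative:
  fixes x :: "real ^ 'n::finite"
  shows "((\<lambda>x. mpoly_eval p (\<lambda>i. x $ i)) has_derivative
    (\<lambda>h. \<Sum>i\<in>UNIV. h $ i * mpoly_eval (mpoly_partial i p) (\<lambda>i. x $ i))) (at x)"
proof -
  have "((\<lambda>x. \<Sum>\<alpha>\<in>Poly_Mapping.keys p. Poly_Mapping.lookup p \<alpha> * monom_eval \<alpha> (\<lambda>i. x $ i))
    has_derivative (\<lambda>h. \<Sum>\<alpha>\<in>Poly_Mapping.keys p. Poly_Mapping.lookup p \<alpha> *
      (\<Sum>i\<in>UNIV. h $ i * (real (Poly_Mapping.lookup \<alpha> i) *
        monom_eval (\<alpha> - Poly_Mapping.single i 1) (\<lambda>i. x $ i))))) (at x)"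
    by (intro has_derivative_sum has_derivative_mult_right monom_eval_has_derivative)
  moreover have "(\<Sum>\<alpha>\<in>Poly_Mapping.keys p. Poly_Mapping.lookup p \<alpha> *
      (\<Sum>i\<in>UNIV. h $ i * (real (Poly_Mapping.lookup \<alpha> i) *
        monom_eval (\<alpha> - Poly_Mapping.single i 1) (\<lambda>i. x $ i)))) =
      (\<Sum>i\<in>UNIV. h $ i * mpoly_eval (mpoly_partial i p) (\<lambda>i. x $ i))" for h :: "real ^ 'n"
    unfolding mpoly_partial_def mpoly_eval_sum sum_distrib_left
    by (subst sum.swap) (simp add: mult_ac)
  ultimately show ?thesis by (simp add: mpoly_eval_def)
qed

text \<open>At \<open>k = 0\<close> the bound \<open>k - 1\<close> truncates to 0 and shows no drop
  in degree; the second claim covers that case.\<close>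

lemma mpoly_partial_le:
  assumes "p \<in> mpolys_le k"
  shows "mpoly_partial (i :: 'n::finite) p \<in> mpolys_le (k - 1)"
    and "k = 0 \<Longrightarrow> mpoly_partial i p = 0"
proof -
  have *: "Suc (monom_degree \<beta>) \<le> k" if "\<beta> \<in> Poly_Mapping.keys (mpoly_partial i p)" for \<beta>
  proof -
    have "\<beta> + Poly_Mapping.single i 1 \<in> Poly_Mapping.keys p"
      using that by (auto simp: in_keys_iff lookup_mpoly_partial)
    then have "monom_degree (\<beta> + Poly_Mapping.single i 1) \<le> k"
      using assms by (simp add: mpolys_le_def)
    then show ?thesis by (simp add: monom_degree_add)
  qed
  show "mpoly_partial i p \<in> mpolys_le (k - 1)"
    unfolding mpolys_le_def using * by fastforce
  assume "k = 0"
  then have "Poly_Mapping.keys (mpoly_partial i p) = {}" using * by fastforce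
  then show "mpoly_partial i p = 0" by simp
qed

text \<open>A monomial with positive exponent of \<open>i\<close> leaves a nonzero term in the
  partial derivative for \<open>i\<close>, since a positive exponent is a nonzero real.\<close>

lemma constant_if_partials_zero:
  assumes "\<And>i. mpoly_partial i p = 0"
  shows "Poly_Mapping.keys p \<subseteq> {0}"
proof
  fix \<alpha> assume \<alpha>: "\<alpha> \<in> Poly_Mapping.keys p"
  show "\<alpha> \<in> {0}"
  proof (rule ccontr)
    assume "\<alpha> \<notin> {0}"
    then obtain i where i: "Poly_Mapping.lookup \<alpha> i \<noteq> 0"
      by (metis lookup_zero poly_mapping_eqI singletonI)
    have "(\<alpha> - Poly_Mapping.single i 1) + Poly_Mapping.single i 1 = \<alpha>"
      by (rule poly_mapping_eqI) (use i in \<open>auto simp: lookup_add lookup_minus lookup_single when_def\<close>)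
    then have "Poly_Mapping.lookup (mpoly_partial i p) (\<alpha> - Poly_Mapping.single i 1) \<noteq> 0"
      using \<alpha> by (simp add: lookup_mpoly_partial in_keys_iff add_nonneg_eq_0_iff)
    then show False using assms by simp
  qed
qed

text \<open>Along a local parametrization \<open>Q\<close> is identically 0. The chain rule writes
  its derivative, which is 0, as the inner product of gradient and tangent vector.\<close>

lemma partials_along_tangent:
  assumes Q: "Q \<in> vanishing_ideal \<gamma>" and v: "tangent_vector \<gamma> x v"
  shows "(\<Sum>i\<in>UNIV. v $ i * mpoly_eval (mpoly_partial i Q) (\<lambda>i. x $ i)) = 0"
proof -
  obtain I g t U h where g: "open I" "t \<in> I" "g t = x" "openin (top_of_set \<gamma>) U"
      "homeomorphism I U g h" "g differentiable (at t)" "v = vector_derivative g (at t)"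
    using v unfolding tangent_vector_def local_parametrization_def by blast
  have "g ` I \<subseteq> \<gamma>"
    using g(4,5) by (auto simp: homeomorphism_def dest: openin_imp_subset)
  then have zero: "mpoly_eval Q (\<lambda>i. g s $ i) = 0" if "s \<in> I" for s
    using Q that by (auto simp: vanishing_ideal_def)
  have g': "(g has_derivative (\<lambda>s. s *\<^sub>R v)) (at t)"
    using g(6) unfolding vector_derivative_works g(7) has_vector_derivative_def .
  have Q': "((\<lambda>y. mpoly_eval Q (\<lambda>i. y $ i)) has_derivative
      (\<lambda>h. \<Sum>i\<in>UNIV. h $ i * mpoly_eval (mpoly_partial i Q) (\<lambda>i. x $ i))) (at (g t))"
    unfolding g(3) by (rule mpoly_eval_has_derivative)
  have "((\<lambda>s. mpoly_eval Q (\<lambda>i. g s $ i)) has_derivative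
      (\<lambda>s. \<Sum>i\<in>UNIV. (s *\<^sub>R v) $ i * mpoly_eval (mpoly_partial i Q) (\<lambda>i. x $ i))) (at t)"
    using diff_chain_at[OF g' Q'] by (simp only: o_def)
  moreover have "((\<lambda>s. mpoly_eval Q (\<lambda>i. g s $ i)) has_derivative (\<lambda>s. 0)) (at t)"
    by (rule has_derivative_transform_within_open[OF has_derivative_const g(1,2)]) (simp add: zero)
  ultimately have "(\<lambda>s. \<Sum>i\<in>UNIV. (s *\<^sub>R v) $ i * mpoly_eval (mpoly_partial i Q) (\<lambda>i. x $ i)) = (\<lambda>s. 0)"
    by (rule has_derivative_unique)
  from fun_cong[OF this, of 1] show ?thesis by simp
qed

lemma partials_zero_at_joint:
  fixes C :: "(real ^ 'n::finite) set set"
  assumes x: "x \<in> joints C" and Q: "\<And>\<gamma>. \<gamma> \<in> C \<Longrightarrow> Q \<in> vanishing_ideal \<gamma>"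
  shows "mpoly_eval (mpoly_partial i Q) (\<lambda>i. x $ i) = 0"
proof -
  obtain c and v :: "'n \<Rightarrow> real ^ 'n" where c: "\<And>j. c j \<in> C" "\<And>j. tangent_vector (c j) x (v j)"
      and v: "inj v" "independent (range v)"
    using x unfolding joints_def by blast
  define w where "w = (\<chi> i. mpoly_eval (mpoly_partial i Q) (\<lambda>i. x $ i))"
  have "w \<bullet> v j = 0" for j
    using partials_along_tangent[OF Q[OF c(1)] c(2)[of j]]
    by (simp add: inner_vec_def w_def mult.commute)
  \<comment> \<open>The \<open>CARD('n)\<close> independent tangent vectors span the whole space, so
    the gradient is orthogonal even to itself.\<close>
  moreover have "UNIV \<subseteq> span (range v)"
    by (rule card_ge_dim_independent) (use v in \<open>simp_all add: card_image\<close>)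
  ultimately have "orthogonal w w"
    by (intro orthogonal_to_span[of w "range v"]) (auto simp: orthogonal_def)
  then have "w = 0" by (simp add: orthogonal_def)
  then have "w $ i = 0" by simp
  then show ?thesis by (simp add: w_def)
qed

section \<open>Coefficient counting and removal of curves\<close>

lemma card_bounded_exponents:
  "card {\<alpha> :: 'n::finite \<Rightarrow>\<^sub>0 nat. \<forall>v. Poly_Mapping.lookup \<alpha> v \<le> q} = (q + 1) ^ CARD('n)"
proof -
  have "bij_betw Poly_Mapping.lookup {\<alpha> :: 'n \<Rightarrow>\<^sub>0 nat. \<forall>v. Poly_Mapping.lookup \<alpha> v \<le> q}
      (PiE UNIV (\<lambda>_. {..q}))"
    by (rule bij_betwI[where g = Abs_poly_mapping]) (auto simp: PiE_def intro: poly_mapping_eqI)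
  then have "card {\<alpha> :: 'n \<Rightarrow>\<^sub>0 nat. \<forall>v. Poly_Mapping.lookup \<alpha> v \<le> q} = card (PiE (UNIV :: 'n set) (\<lambda>_. {..q}))"
    by (rule bij_betw_same_card)
  then show ?thesis by (simp add: card_PiE)
qed

text \<open>The coefficients are unknowns, the points equations. Exponents are taken from the box
  with each entry at most \<open>q\<close>, which has exactly \<open>(q + 1) ^ CARD('n)\<close>
  elements; the price is a factor \<open>CARD('n)\<close> in the degree.\<close>

lemma vanishing_poly_exists:
  fixes J :: "(real ^ 'n::finite) set"
  assumes "finite J" "card J < (q + 1) ^ CARD('n)"
  shows "\<exists>Q. Q \<noteq> 0 \<and> Q \<in> mpolys_le (CARD('n) * q) \<and> (\<forall>x\<in>J. mpoly_eval Q (\<lambda>i. x $ i) = 0)"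
proof -
  let ?A = "{\<alpha> :: 'n \<Rightarrow>\<^sub>0 nat. \<forall>v. Poly_Mapping.lookup \<alpha> v \<le> q}"
  have fin: "finite ?A" by (rule finite_bounded_exponents)
  obtain c where c: "\<exists>\<alpha>\<in>?A. c \<alpha> \<noteq> 0"
      "\<forall>x\<in>J. (\<Sum>\<alpha>\<in>?A. c \<alpha> * monom_eval \<alpha> (\<lambda>i. x $ i)) = 0"
    using underdetermined_system[OF assms(1) fin, of "\<lambda>\<alpha> x. monom_eval \<alpha> (\<lambda>i. x $ i)"] assms(2)
    unfolding card_bounded_exponents by blast
  define Q where "Q = (\<Sum>\<alpha>\<in>?A. Poly_Mapping.single \<alpha> (c \<alpha>))"
  have lookup: "Poly_Mapping.lookup Q \<beta> = (if \<beta> \<in> ?A then c \<beta> else 0)" for \<beta>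
    using fin by (simp add: Q_def lookup_sum lookup_single when_def)
  have "Q \<noteq> 0" using c(1) lookup by (metis lookup_zero)
  moreover have "monom_degree \<beta> \<le> CARD('n) * q" if "\<beta> \<in> Poly_Mapping.keys Q" for \<beta>
  proof -
    have "\<beta> \<in> ?A" using that lookup[of \<beta>] by (auto simp: in_keys_iff split: if_splits)
    then have "(\<Sum>v\<in>UNIV. Poly_Mapping.lookup \<beta> v) \<le> (\<Sum>v\<in>(UNIV :: 'n set). q)"
      by (intro sum_mono) simp
    then show ?thesis by (simp add: monom_degree_UNIV)
  qed
  moreover have "mpoly_eval Q (\<lambda>i. x $ i) = 0" if "x \<in> J" for x
    using c(2) that unfolding Q_def mpoly_eval_sum mpoly_eval_single by blast
  ultimately show ?thesis unfolding mpolys_le_def by blast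
qed

lemma curve_with_few_joints:
  fixes C :: "(real ^ 'n::finite) set set"
  assumes C: "\<And>\<gamma>. \<gamma> \<in> C \<Longrightarrow> irreducible_algebraic_curve \<gamma> \<and> alg_degree \<gamma> \<le> real d"
    and J: "finite J" "J \<subseteq> joints C" "J \<noteq> {}" "card J < (q + 1) ^ CARD('n)"
  shows "\<exists>\<gamma>\<in>C. card (\<gamma> \<inter> J) \<le> d * (CARD('n) * q)"
proof (rule ccontr)
  assume "\<not> ?thesis"
  then have many: "d * (CARD('n) * q) < card (\<gamma> \<inter> J)" if "\<gamma> \<in> C" for \<gamma> using that by force
  define P where "P k = (\<exists>Q :: ('n, real) mpoly. Q \<noteq> 0 \<and> Q \<in> mpolys_le k \<and> (\<forall>x\<in>J. mpoly_eval Q (\<lambda>i. x $ i) = 0))" for k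
  define k where "k = (LEAST k. P k)"
  have Pq: "P (CARD('n) * q)" unfolding P_def by (rule vanishing_poly_exists[OF J(1,4)])
  have kq: "k \<le> CARD('n) * q" unfolding k_def using Pq by (rule Least_le)
  have "P k" unfolding k_def using Pq by (rule LeastI)
  then obtain Q :: "('n, real) mpoly" where Q: "Q \<noteq> 0" "Q \<in> mpolys_le k" "\<And>x. x \<in> J \<Longrightarrow> mpoly_eval Q (\<lambda>i. x $ i) = 0"
    by (auto simp: P_def)
  have van: "Q \<in> vanishing_ideal \<gamma>" if \<gamma>: "\<gamma> \<in> C" for \<gamma>
  proof (rule vanishes_on_curve_if_many_zeros[OF _ _ Q(2)])
    show "irreducible_algebraic_curve \<gamma>" "alg_degree \<gamma> \<le> real d" using C[OF \<gamma>] by auto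
    show "finite (\<gamma> \<inter> J)" using J(1) by simp
    have "d * k \<le> d * (CARD('n) * q)" using kq by simp
    then show "d * k < card (\<gamma> \<inter> J)" using many[OF \<gamma>] by linarith
  qed (use Q(3) in auto)
  have "mpoly_partial i Q = 0" for i
  proof (rule ccontr)
    assume nz: "mpoly_partial i Q \<noteq> 0"
    \<comment> \<open>The partial derivative vanishes at all joints in \<open>J\<close>, so it would
      be a smaller witness. For \<open>k = 0\<close>, where \<open>k - 1\<close> is not smaller, it
      is 0 anyway.\<close>
    have "P (k - 1)"
      unfolding P_def using nz mpoly_partial_le(1)[OF Q(2), of i] partials_zero_at_joint[of _ C Q i] van J(2)
      by blast
    then have "k \<le> k - 1" unfolding k_def by (rule Least_le)
    then show False using nz mpoly_partial_le(2)[OF Q(2)] by simp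
  qed
  then have keys: "Poly_Mapping.keys Q \<subseteq> {0}" by (rule constant_if_partials_zero)
  \<comment> \<open>A constant vanishing at a point is 0; here \<open>J\<close> has to be
    nonempty.\<close>
  obtain x where "x \<in> J" using J(3) by blast
  then have "Poly_Mapping.lookup Q 0 = 0"
    using Q(3)[of x] mpoly_eval_superset[OF _ keys] by simp
  then have "0 \<notin> Poly_Mapping.keys Q" by (simp add: in_keys_iff)
  with keys have "Poly_Mapping.keys Q = {}" by blast
  then show False using Q(1) by simp
qed

text \<open>A curve through a point outside \<open>\<gamma>\<close> differs from
  \<open>\<gamma>\<close>, so the witnessing curves all survive the removal.\<close>

lemma joints_remove:
  fixes C :: "(real ^ 'n::finite) set set"
  assumes "J \<subseteq> joints C"
  shows "J - \<gamma> \<subseteq> joints (C - {\<gamma>})"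
proof
  fix x assume x: "x \<in> J - \<gamma>"
  then obtain c and v :: "'n \<Rightarrow> real ^ 'n" where c: "inj c" "\<forall>i. c i \<in> C \<and> x \<in> c i \<and> tangent_vector (c i) x (v i)"
      and v: "inj v" "independent (range v)"
    using assms unfolding joints_def by blast
  have "c i \<in> C - {\<gamma>}" for i using c(2) x by blast
  then show "x \<in> joints (C - {\<gamma>})"
    unfolding joints_def mem_Collect_eq using c v by (intro exI[of _ c] exI[of _ v] conjI allI) simp_all
qed

text \<open>Remove a curve with few points of \<open>J\<close>, together with these points, and
  repeat. The number \<open>q\<close> stays fixed, as shrinking \<open>J\<close> preserves the bound
  on its size.\<close>

lemma card_joints_le:
  fixes C :: "(real ^ 'n::finite) set set"
  assumes "finite C" "\<And>\<gamma>. \<gamma> \<in> C \<Longrightarrow> irreducible_algebraic_curve \<gamma> \<and> alg_degree \<gamma> \<le> real d"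
    and "finite J" "J \<subseteq> joints C" "card J < (q + 1) ^ CARD('n)"
  shows "card J \<le> card C * (d * (CARD('n) * q))"
  using assms
proof (induction "card C" arbitrary: C J)
  case 0
  then have "C = {}" by simp
  then have "J = {}" using 0 by (auto simp: joints_def)
  then show ?case by simp
next
  case (Suc N)
  show ?case
  proof (cases "J = {}")
    case False
    obtain \<gamma> where \<gamma>: "\<gamma> \<in> C" "card (\<gamma> \<inter> J) \<le> d * (CARD('n) * q)"
      using curve_with_few_joints[OF Suc.prems(2,3,4) False Suc.prems(5)] by blast
    have N: "N = card (C - {\<gamma>})" using Suc.hyps(2) Suc.prems(1) \<gamma>(1) by simp
    have "card (J - \<gamma>) \<le> card J" using Suc.prems(3) by (intro card_mono) auto
    then have "card (J - \<gamma>) \<le> card (C - {\<gamma>}) * (d * (CARD('n) * q))"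
      using Suc.prems \<gamma>(1) by (intro Suc.hyps(1)[OF N] joints_remove) auto
    moreover have "card J = card (\<gamma> \<inter> J) + card (J - \<gamma>)"
    proof -
      have "card J = card (J \<inter> \<gamma>) + card (J - \<gamma>)"
        using Suc.prems(3) by (rule card_Int_Diff)
      then show ?thesis by (simp add: Int_commute)
    qed
    ultimately show ?thesis using \<gamma>(2) N Suc.hyps(2)[symmetric] by simp
  qed simp
qed

lemma finite_joints_bound:
  fixes C :: "(real ^ 'n::finite) set set"
  assumes n: "CARD('n) \<ge> 2" and C: "finite C"
    "\<And>\<gamma>. \<gamma> \<in> C \<Longrightarrow> irreducible_algebraic_curve \<gamma> \<and> alg_degree \<gamma> \<le> real d"
    and J: "finite J" "J \<subseteq> joints C"
  shows "real (card J) \<le> (real CARD('n) * (real (card C) * real d)) powr (real CARD('n) / (real CARD('n) - 1))"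
proof (cases "card J = 0")
  case False
  let ?n = "real CARD('n)" and ?M = "real (card J)"
  \<comment> \<open>The least \<open>q\<close> with \<open>card J < (q + 1) ^ CARD('n)\<close>; its
    upper bound by the root of \<open>?M\<close> feeds the counting estimate.\<close>
  define q where "q = nat \<lfloor>?M powr (1 / ?n)\<rfloor>"
  have M: "?M > 0" using False by simp
  have q: "real q \<le> ?M powr (1 / ?n)" "?M powr (1 / ?n) < real q + 1"
    by (simp_all add: q_def)
  have "?M = (?M powr (1 / ?n)) powr ?n" using M n by (simp add: powr_powr)
  also have "\<dots> < (real q + 1) powr ?n" using q(2) n by (intro powr_less_mono2) auto
  also have "\<dots> = real ((q + 1) ^ CARD('n))" by (simp add: powr_realpow add.commute)
  finally have lt: "card J < (q + 1) ^ CARD('n)" by (simp only: of_nat_less_iff)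
  have "?M \<le> real (card C * (d * (CARD('n) * q)))"
    using card_joints_le[OF C J lt] by (simp only: of_nat_le_iff)
  also have "\<dots> = (?n * (real (card C) * real d)) * real q" by simp
  also have "\<dots> \<le> (?n * (real (card C) * real d)) * ?M powr (1 / ?n)"
    using q(1) by (intro mult_left_mono) auto
  \<comment> \<open>Dividing by the root leaves \<open>?M\<close> to the power
    \<open>1 - 1 / ?n\<close>; the exponent \<open>?n / (?n - 1)\<close> then undoes this power, as
    \<open>?n\<close> is at least 2.\<close>
  finally have "?M / ?M powr (1 / ?n) \<le> ?n * (real (card C) * real d)"
    using M by (simp add: pos_divide_le_eq)
  moreover have "?M / ?M powr (1 / ?n) = ?M powr (1 - 1 / ?n)"
    using M by (simp add: powr_diff)
  ultimately have "?M powr (1 - 1 / ?n) \<le> ?n * (real (card C) * real d)" by simp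
  then have "(?M powr (1 - 1 / ?n)) powr (?n / (?n - 1)) \<le>
      (?n * (real (card C) * real d)) powr (?n / (?n - 1))"
    using n by (intro powr_mono2) auto
  moreover have "(1 - 1 / ?n) * (?n / (?n - 1)) = 1" using n by (simp add: field_simps)
  ultimately show ?thesis using M by (simp add: powr_powr)
qed simp

theorem theorem2:
  assumes "CARD('n::finite) \<ge> 2"
  shows "\<exists>K>0. \<forall>d::nat. d \<ge> 1 \<longrightarrow>
    (\<forall>C :: (real ^ 'n) set set.
       finite C \<and>
       (\<forall>\<gamma>\<in>C. irreducible_algebraic_curve \<gamma> \<and> smooth_curve \<gamma> \<and> alg_degree \<gamma> \<le> real d) \<longrightarrow>
       finite (joints C) \<and>
       real (card (joints C)) \<le>
         K * real (card C) powr (real CARD('n) / (real CARD('n) - 1))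
           * real d powr (real CARD('n) / (real CARD('n) - 1)))"
proof (intro exI[of _ "real CARD('n) powr (real CARD('n) / (real CARD('n) - 1))"] conjI allI impI)
  show "0 < real CARD('n) powr (real CARD('n) / (real CARD('n) - 1))" by simp
  fix d :: nat and C :: "(real ^ 'n) set set"
  assume C: "finite C \<and>
    (\<forall>\<gamma>\<in>C. irreducible_algebraic_curve \<gamma> \<and> smooth_curve \<gamma> \<and> alg_degree \<gamma> \<le> real d)"
  let ?B = "(real CARD('n) * (real (card C) * real d)) powr (real CARD('n) / (real CARD('n) - 1))"
  have B: "real (card J) \<le> ?B" if "finite J" "J \<subseteq> joints C" for J
    by (rule finite_joints_bound[OF assms _ _ that]) (use C in auto)
  \<comment> \<open>The bound holds for every finite set of joints, while an infinite set of joints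
    would contain finite subsets of any size.\<close>
  show fin: "finite (joints C)"
  proof (rule ccontr)
    assume "infinite (joints C)"
    then obtain J where "J \<subseteq> joints C" "finite J" "card J = Suc (nat \<lceil>?B\<rceil>)"
      by (metis infinite_arbitrarily_large)
    then have "real (Suc (nat \<lceil>?B\<rceil>)) \<le> ?B" using B by metis
    moreover have "?B \<le> real (nat \<lceil>?B\<rceil>)" by (rule of_nat_ceiling)
    ultimately show False by linarith
  qed
  have "real (card (joints C)) \<le> ?B" by (rule B[OF fin order_refl])
  \<comment> \<open>Distributing the power over the product isolates the constant, a power of
    \<open>CARD('n)\<close> alone.\<close>
  then show "real (card (joints C)) \<le> real CARD('n) powr (real CARD('n) / (real CARD('n) - 1)) *
      real (card C) powr (real CARD('n) / (real CARD('n) - 1)) *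
      real d powr (real CARD('n) / (real CARD('n) - 1))"
    by (simp add: powr_mult mult_ac)
qed

end
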